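(* For any integer $n\ge 0$, $$A_{5,1}(n)=\sigma_{1,\chi_{5,3}}^*(n+1).$$
   Context: A partition is called $t$-core if none of its hook numbers (hook lengths) is a multiple of $t$ (the empty partition is $t$-core). A partition $k$-tuple of $n$ is an ordered $k$-tuple $(\lambda_1,\ldots,\lambda_k)$ of (possibly empty) partitions such that the sum of all the parts of all the $\lambda_i$ equals $n$. $A_{t,k}(n)$ denotes the number of partition $k$-tuples of $n$ in which each $\lambda_i$ is $t$-core; in particular $A_{5,1}(n)=A_5(n)$ is the number of $5$-core partitions of $n$. $\chi_{5,3}$ is the Dirichlet character mod $5$ given by $\chi_{5,3}(n)=1$ if $n\equiv 1,4\pmod 5$, $\chi_{5,3}(n)=-1$ if $n\equiv 2,3\pmod 5$, and $\chi_{5,3}(n)=0$ if $\gcd(n,5)>1$. For $n\ge 1$, $\sigma_{1,\chi_{5,3}}^*(n)=\sum_{d\mid n}\chi_{5,3}(n/d)\,d$, the sum being over positive divisors $d$ of $n$. *)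

theory Defs
  imports Complex_Main
begin

text \<open>A partition is the weakly decreasing list of its (positive) parts; the empty list is the
  empty partition.\<close>

definition is_partition :: "nat list \<Rightarrow> bool" where
  "is_partition p \<longleftrightarrow> sorted_wrt (\<ge>) p \<and> (\<forall>x\<in>set p. 0 < x)"

definition young_diagram :: "nat list \<Rightarrow> (nat \<times> nat) set" where
  "young_diagram p = {(i, j). i < length p \<and> j < p ! i}"

text \<open>Cells are (row, column), counted from 0. The hook number of a cell is the number of cells
  weakly to its right in its row or weakly below it in its column, the cell itself counted once.\<close>

definition hook_number :: "nat list \<Rightarrow> nat \<times> nat \<Rightarrow> nat" where
  "hook_number p c = card {d \<in> young_diagram p.
     (fst d = fst c \<and> snd c \<le> snd d) \<or> (snd d = snd c \<and> fst c \<le> fst d)}"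

definition is_core :: "nat \<Rightarrow> nat list \<Rightarrow> bool" where
  "is_core t p \<longleftrightarrow> (\<forall>c\<in>young_diagram p. \<not> t dvd hook_number p c)"

definition partition_tuples :: "nat \<Rightarrow> nat \<Rightarrow> nat list list set" where
  "partition_tuples k n =
     {ps. length ps = k \<and> (\<forall>p\<in>set ps. is_partition p) \<and> (\<Sum>p\<leftarrow>ps. sum_list p) = n}"

definition A_core :: "nat \<Rightarrow> nat \<Rightarrow> nat \<Rightarrow> nat" where
  "A_core t k n = card {ps \<in> partition_tuples k n. \<forall>p\<in>set ps. is_core t p}"

text \<open>The cardinality in \<open>A_core\<close> is that of a finite set.\<close>

lemma finite_partition_tuples: "finite (partition_tuples k n)"
proof -
  let ?P = "\<Union>l\<le>n. {p. set p \<subseteq> {..n} \<and> length p = l}"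
  have len: "length p \<le> sum_list p" if "\<forall>x\<in>set p. 0 < x" for p :: "nat list"
    using that by (induction p) auto
  have fin: "finite ?P" by (auto intro: finite_lists_length_eq)
  have "ps \<in> {ps. set ps \<subseteq> ?P \<and> length ps = k}" if "ps \<in> partition_tuples k n" for ps
  proof -
    have "p \<in> ?P" if p: "p \<in> set ps" for p
    proof -
      have "sum_list p \<le> n"
        using member_le_sum_list[of "sum_list p" "map sum_list ps"] p \<open>ps \<in> partition_tuples k n\<close>
        by (auto simp: partition_tuples_def)
      moreover have "length p \<le> sum_list p"
        using len[of p] p \<open>ps \<in> partition_tuples k n\<close>
        by (auto simp: partition_tuples_def is_partition_def)
      moreover have "x \<le> sum_list p" if "x \<in> set p" for x
        using member_le_sum_list[OF that] by simp
      ultimately show ?thesis by force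
    qed
    then show ?thesis using that by (auto simp: partition_tuples_def)
  qed
  then have "partition_tuples k n \<subseteq> {ps. set ps \<subseteq> ?P \<and> length ps = k}" by blast
  then show ?thesis by (rule finite_subset[OF _ finite_lists_length_eq[OF fin]])
qed

definition chi_5_3 :: "int \<Rightarrow> int" where
  "chi_5_3 n = (if n mod 5 \<in> {1, 4} then 1 else if n mod 5 \<in> {2, 3} then - 1 else 0)"

text \<open>Meaningful for \<open>n \<ge> 1\<close>.\<close>

definition sigma1_star :: "(int \<Rightarrow> int) \<Rightarrow> nat \<Rightarrow> int" where
  "sigma1_star \<chi> n = (\<Sum>d | d dvd n. \<chi> (int (n div d)) * int d)"

end

theory Submission
  imports Defs "HOL-Complex_Analysis.Cauchy_Integral_Formula"
begin

text \<open>
Write \<open>(q)\<close> for the product of all \<open>1 - q^k\<close> with \<open>k \<ge> 1\<close>. Both sides of the theorem are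
coefficients of \<open>q (q^5)^5 / (q)\<close>: the number of 5-cores of \<open>n\<close> is the coefficient of
\<open>q^(n+1)\<close> because of the abacus, and the divisor sum at \<open>n + 1\<close> is the same coefficient because of
Ramanujan's identity \<open>\<Sum>m. \<chi>(m) q^m / (1 - q^m)^2 = q (q^5)^5 / (q)\<close>. All series are treated as
absolutely convergent sums for real \<open>0 < q < 1\<close>; at the end the coefficients of two power series
that agree on this interval are compared.

Everything rests on the series \<open>\<theta>(q, w) = \<Sum>j. w^j q^(j(j-1)/2)\<close> over the integers and on Jacobi's
triple product, \<open>jacobi_triple_product\<close>.

\<^bold>\<open>Cores.\<close> Replace a partition by its set of beads, the hook lengths in the first column of the
diagram padded with empty rows. The hook lengths in a row are the distances from a bead down to the
positions without a bead (\<open>hooks_of_row\<close>). So a partition is a \<open>t\<close>-core exactly if no bead can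
be moved down by \<open>t\<close>, and then it is determined by the number of beads in each residue class modulo
\<open>t\<close>, that is, by a vector of \<open>t\<close> integers with sum zero; its size is the value of a quadratic
polynomial, here called energy (\<open>A_core_charge_vectors\<close>). The product of the series
\<open>\<theta>(q^t, q^i)\<close> with \<open>i < t\<close> is the sum of \<open>q^energy\<close> over all integer vectors. A cyclic
rotation raises the sum of the entries by one and the energy by the old sum, so the vectors with sum
\<open>s\<close> contribute \<open>q^(s(s-1)/2)\<close> times what the vectors with sum 0 contribute
(\<open>sector_sum_eq\<close>). Hence the product is the generating function of the \<open>t\<close>-cores times
\<open>\<theta>(q, 1)\<close>, and the triple product turns this into \<open>(q^t)^t / (q)\<close>
(\<open>zero_sector_product\<close>).

\<^bold>\<open>Divisor sums.\<close> Expanding \<open>q^m / (1 - q^m)^2 = \<Sum>d. d q^(m d)\<close> gives the divisor sums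
(\<open>chi_lambert_has_sum\<close>). With nome \<open>q^5\<close>, the Lambert series is the difference of the values at
\<open>-q^2\<close> and \<open>-q\<close> of the second logarithmic derivative of \<open>\<theta>\<close>
(\<open>theta_log_derivative\<close>). Differences of this kind are products of theta values, just as
\<open>\<wp>(u) - \<wp>(v)\<close> is a product of sigma functions (\<open>weierstrass_difference\<close>): the functions
\<open>x \<mapsto> \<theta>(w x) \<theta>(w / x)\<close> all lie in a space of dimension two, so \<open>\<theta>(w)^2\<close> and the product
of \<open>\<theta>(w)^2\<close> with the second logarithmic derivative are two linear combinations of the same two
functions of \<open>w\<close>, and their determinant at two points \<open>w\<close> and \<open>u\<close> is, up to a factor, the
product \<open>\<theta>(w x) \<theta>(w / x)\<close> at \<open>x = -u\<close>.

Derivatives never appear as limits. The operator \<open>w d/dw\<close> is the weight \<open>j\<close> in the theta series,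
and the weighted series are controlled through the finite form of the triple product, in which the
factors can be attached one at a time.
\<close>

section \<open>Unordered sums\<close>

text \<open>Tannery's theorem for sums without an order: dominated convergence for the counting measure.\<close>

lemma tendsto_infsum_dominated:
  fixes f :: "nat \<Rightarrow> 'a \<Rightarrow> real"
  assumes lim: "\<And>x. (\<lambda>n. f n x) \<longlonglongrightarrow> g x"
      and bound: "\<And>n x. \<bar>f n x\<bar> \<le> h x"
      and h: "h summable_on UNIV"
  shows "(\<lambda>n. infsum (f n) UNIV) \<longlonglongrightarrow> infsum g UNIV"
proof -
  have h0: "h x \<ge> 0" for x using bound[of 0 x] by linarith
  have h': "(\<lambda>x. norm (h x)) summable_on UNIV" using h h0 by simp
  have int: "integrable (count_space UNIV) h"
    using h' unfolding abs_summable_equivalent abs_summable_on_def .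
  have gb: "\<bar>g x\<bar> \<le> h x" for x
    by (rule LIMSEQ_le_const2[OF tendsto_rabs[OF lim]]) (use bound in auto)
  have fs: "(\<lambda>x. norm (f n x)) summable_on UNIV" for n
    by (rule Infinite_Sum.abs_summable_on_comparison_test'[OF h]) (use bound in auto)
  have gs: "(\<lambda>x. norm (g x)) summable_on UNIV"
    by (rule Infinite_Sum.abs_summable_on_comparison_test'[OF h]) (use gb in auto)
  have "(\<lambda>n. integral\<^sup>L (count_space UNIV) (f n)) \<longlonglongrightarrow> integral\<^sup>L (count_space UNIV) g"
    by (rule integral_dominated_convergence[where w = h]) (use lim bound int in auto)
  moreover have "integral\<^sup>L (count_space UNIV) (f n) = infsum (f n) UNIV" for n
    using infsetsum_infsum[OF fs[of n, unfolded abs_summable_equivalent]] by (simp add: infsetsum_def)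
  moreover have "integral\<^sup>L (count_space UNIV) g = infsum g UNIV"
    using infsetsum_infsum[OF gs[unfolded abs_summable_equivalent]] by (simp add: infsetsum_def)
  ultimately show ?thesis by simp
qed

text \<open>Over the reals every summable family is absolutely summable, which gives the summability of the double
  family.\<close>

lemma has_sum_mult:
  fixes f :: "'a \<Rightarrow> real" and g :: "'b \<Rightarrow> real"
  assumes sf: "f summable_on A" and sg: "g summable_on B"
  shows "((\<lambda>(x, y). f x * g y) has_sum (infsum f A * infsum g B)) (A \<times> B)"
proof -
  have f: "(\<lambda>x. norm (f x)) summable_on A" and g: "(\<lambda>x. norm (g x)) summable_on B"
    using sf sg summable_on_iff_abs_summable_on_real by blast+
  have sm: "(\<lambda>p. norm (case p of (x, y) \<Rightarrow> f x * g y)) summable_on A \<times> B"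
    by (rule Infinite_Sum.abs_summable_on_Sigma_iff[THEN iffD2])
       (use f g in \<open>auto simp: abs_mult infsum_cmult_right' intro!: summable_on_cmult_right summable_on_cmult_left\<close>)
  show ?thesis
  proof (rule has_sum_SigmaI[where g = "\<lambda>x. f x * infsum g B"])
    show "((\<lambda>y. case (x, y) of (x, y) \<Rightarrow> f x * g y) has_sum f x * infsum g B) B" for x
      using sg by (auto intro: has_sum_cmult_right)
    show "((\<lambda>x. f x * infsum g B) has_sum infsum f A * infsum g B) A"
      using sf by (intro has_sum_cmult_left) auto
    show "(\<lambda>(x, y). f x * g y) summable_on A \<times> B" using sm by (rule abs_summable_summable)
  qed
qed

lemma summable_on_int:
  fixes g :: "int \<Rightarrow> real"
  assumes a: "summable a" and b: "\<And>n. \<bar>g (int n)\<bar> \<le> a n" "\<And>n. \<bar>g (- int n)\<bar> \<le> a n"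
  shows "g summable_on UNIV"
proof -
  have an: "a n \<ge> 0" for n using b(1)[of n] by linarith
  have a': "a summable_on UNIV" using a an by (simp add: summable_on_UNIV_nonneg_real_iff)
  have 1: "(\<lambda>j. norm (g j)) summable_on range int"
    by (subst summable_on_reindex) (use a' b in \<open>auto simp: o_def intro: summable_on_comparison_test\<close>)
  have 2: "(\<lambda>j. norm (g j)) summable_on range (\<lambda>n. - int n)"
    by (subst summable_on_reindex) (use a' b in \<open>auto simp: o_def inj_on_def intro: summable_on_comparison_test\<close>)
  have "j \<in> range int \<union> range (\<lambda>n. - int n)" for j
    by (cases j rule: int_cases2) auto
  then have "UNIV = range int \<union> range (\<lambda>n. - int n)" by blast
  with summable_on_union[OF 1 2] show ?thesis using summable_on_iff_abs_summable_on_real by auto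
qed

section \<open>Theta series\<close>

definition tri :: "int \<Rightarrow> int" where "tri j = j * (j - 1) div 2"

lemma two_tri: "2 * tri j = j * (j - 1)"
proof -
  have "even (j * (j - 1))" by auto
  then show ?thesis by (simp add: tri_def)
qed

lemma tri_eqI: "2 * x = j * (j - 1) \<Longrightarrow> tri j = x"
  using two_tri[of j] by linarith

lemma tri_nonneg: "tri j \<ge> 0"
proof -
  have "j * (j - 1) \<ge> 0"
    by (cases "j \<le> 0") (auto intro: mult_nonpos_nonpos mult_nonneg_nonneg)
  then show ?thesis using two_tri[of j] by linarith
qed

lemma tri_add1: "tri (j + 1) = tri j + j"
  by (rule tri_eqI) (use two_tri[of j] in \<open>simp add: algebra_simps\<close>)

lemma tri_minus: "tri (- j) = tri j + j"
  by (rule tri_eqI) (use two_tri[of j] in \<open>simp add: algebra_simps\<close>)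

lemma tri_one_minus: "tri (1 - j) = tri j"
  by (rule tri_eqI) (use two_tri[of j] in \<open>simp add: algebra_simps\<close>)

lemma summable_gaussian:
  fixes q W :: real
  assumes "0 < q" "q < 1" "W > 0"
  shows "summable (\<lambda>n. W ^ n * q powi tri (int n))"
proof -
  have "(\<lambda>n. W * q ^ n) \<longlonglongrightarrow> W * 0"
    using assms by (intro tendsto_intros LIMSEQ_power_zero) auto
  then have "\<forall>\<^sub>F n in sequentially. W * q ^ n < 1/2"
    by (rule order_tendstoD) auto
  then obtain N where N: "\<And>n. n \<ge> N \<Longrightarrow> W * q ^ n < 1/2"
    by (auto simp: eventually_sequentially)
  show ?thesis
  proof (rule summable_ratio_test[of "1/2" N])
    fix n assume "n \<ge> N"
    have "W ^ Suc n * q powi tri (int (Suc n)) = (W * q ^ n) * (W ^ n * q powi tri (int n))"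
      using assms tri_add1[of "int n"] by (simp add: power_int_add add.commute)
    moreover have "(W * q ^ n) * (W ^ n * q powi tri (int n)) \<le> 1/2 * (W ^ n * q powi tri (int n))"
      using N[OF \<open>n \<ge> N\<close>] assms by (intro mult_right_mono) auto
    ultimately show "norm (W ^ Suc n * q powi tri (int (Suc n))) \<le> 1/2 * norm (W ^ n * q powi tri (int n))"
      using assms by simp
  qed auto
qed

lemma power_le_4: 
  assumes "i \<le> 2" shows "\<bar>real n ^ i\<bar> \<le> 4 ^ n"
proof -
  have 1: "real n \<le> 2 ^ n" using of_nat_less_two_power[of n, where 'a=real] by linarith
  have "real n ^ i \<le> (2 ^ n) ^ i" using 1 by (intro power_mono) auto
  also have "\<dots> \<le> (2 ^ n) ^ 2" using assms by (intro power_increasing) auto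
  also have "\<dots> = 4 ^ n" by (simp add: power2_eq_square flip: power_mult_distrib)
  finally show ?thesis by simp
qed

text \<open>The weight \<open>j ^ i\<close> is at most \<open>4 ^ n\<close> for \<open>n = \<bar>j\<bar>\<close> and can
  be absorbed into the base of \<open>w ^ j\<close>, which leaves the series of
  \<open>W ^ n * q ^ (n (n - 1) / 2)\<close>.\<close>

lemma theta_summable:
  fixes q w :: real
  assumes "0 < q" "q < 1" "w \<noteq> 0" "i \<le> 2"
  shows "(\<lambda>j. of_int j ^ i * w powi j * q powi tri j) summable_on UNIV"
proof -
  define W where "W = max \<bar>w\<bar> (1 / \<bar>w\<bar>)"
  have W: "W > 0" "\<bar>w\<bar> \<le> W" "1 / \<bar>w\<bar> \<le> W" using assms by (auto simp: W_def less_max_iff_disj)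
  show ?thesis
  proof (rule summable_on_int)
    show "summable (\<lambda>n. (4 * W) ^ n * q powi tri (int n))"
      using assms W by (intro summable_gaussian) auto
    fix n
    show "\<bar>of_int (int n) ^ i * w powi int n * q powi tri (int n)\<bar> \<le> (4 * W) ^ n * q powi tri (int n)"
      using assms W power_le_4[of i n]
      by (auto simp: abs_mult power_abs power_mult_distrib intro!: mult_mono power_mono)
    have 1: "q powi tri (- int n) \<le> q powi tri (int n)"
      using assms by (intro power_int_decreasing) (auto simp: tri_minus)
    have 2: "\<bar>w powi (- int n)\<bar> \<le> W ^ n"
      using power_mono[OF W(3), of n] by (simp add: power_int_minus power_abs field_simps power_inverse)
    show "\<bar>of_int (- int n) ^ i * w powi (- int n) * q powi tri (- int n)\<bar> \<le> (4 * W) ^ n * q powi tri (int n)"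
      unfolding abs_mult power_mult_distrib
      by (intro mult_mono) (use 1 2 assms W power_le_4[of i n] in \<open>auto simp: power_abs\<close>)
  qed
qed

text \<open>The index \<open>i\<close> counts applications of \<open>w d/dw\<close>. With \<open>w\<close> in place of
  the usual \<open>-z\<close> the terms carry no signs, so that \<open>w = -1\<close> is the zero of the series.\<close>

definition theta :: "nat \<Rightarrow> real \<Rightarrow> real \<Rightarrow> real" where
  "theta i q w = (\<Sum>\<^sub>\<infinity>j. of_int j ^ i * w powi j * q powi tri j)"

section \<open>Gaussian binomial coefficients\<close>

definition qpoch :: "real \<Rightarrow> nat \<Rightarrow> real" where
  "qpoch q n = (\<Prod>k<n. 1 - q ^ Suc k)"

definition euler :: "real \<Rightarrow> real" where
  "euler q = (\<Prod>k. 1 - q ^ Suc k)"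

lemma qpoch_Suc: "qpoch q (Suc n) = qpoch q n * (1 - q ^ Suc n)"
  by (simp add: qpoch_def)

context
  fixes q :: real
  assumes q: "0 < q" "q < 1"
begin

lemma one_minus_power_bounds: "0 < 1 - q ^ Suc k" "1 - q ^ Suc k \<le> 1"
  using q power_Suc_less_one[of q k] by auto

lemma qpoch_pos: "qpoch q n > 0"
  unfolding qpoch_def by (intro prod_pos) (use one_minus_power_bounds in auto)

lemma qpoch_antimono: "m \<le> n \<Longrightarrow> qpoch q n \<le> qpoch q m"
proof (induction n rule: dec_induct)
  case (step n)
  have "qpoch q (Suc n) \<le> qpoch q n * 1"
    unfolding qpoch_Suc by (intro mult_left_mono) (use one_minus_power_bounds(2)[of n] qpoch_pos[of n] in auto)
  with step show ?case by simp
qed auto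

lemma euler_pos: "euler q > 0" and qpoch_lim: "qpoch q \<longlonglongrightarrow> euler q"
proof -
  have "summable (\<lambda>k. norm ((1 - q ^ Suc k) - 1))"
    using q by (simp add: summable_mult summable_geometric)
  then have c: "convergent_prod (\<lambda>k. 1 - q ^ Suc k)"
    by (intro abs_convergent_prod_imp_convergent_prod summable_imp_abs_convergent_prod)
  have nz: "1 - q ^ Suc k \<noteq> 0" for k using one_minus_power_bounds(1)[of k] by simp
  have "(\<lambda>n. \<Prod>k\<le>n. 1 - q ^ Suc k) \<longlonglongrightarrow> euler q"
    unfolding euler_def by (rule convergent_prod_LIMSEQ[OF c])
  then have "(\<lambda>n. qpoch q (Suc n)) \<longlonglongrightarrow> euler q" 
    by (simp only: qpoch_def lessThan_Suc_atMost)
  then show l: "qpoch q \<longlonglongrightarrow> euler q" by (rule LIMSEQ_imp_Suc)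
  have "euler q \<noteq> 0" unfolding euler_def using prodinf_nonzero[OF c] nz by auto
  moreover have "euler q \<ge> 0"
    by (rule LIMSEQ_le_const[OF l]) (use qpoch_pos less_imp_le in blast)
  ultimately show "euler q > 0" by simp
qed

lemma euler_le_qfac: "euler q \<le> qpoch q n"
  by (rule LIMSEQ_le_const2[OF qpoch_lim]) (use qpoch_antimono in blast)

end

text \<open>An integer lower index, with the value 0 outside \<open>{0..n}\<close>, lets the Pascal rules hold without
  boundary cases.\<close>

definition qbin :: "real \<Rightarrow> nat \<Rightarrow> int \<Rightarrow> real" where
  "qbin q n k = (if 0 \<le> k \<and> k \<le> int n
     then qpoch q n / (qpoch q (nat k) * qpoch q (n - nat k)) else 0)"

lemma qbin_eq: "qbin q (a + b) (int a) = qpoch q (a + b) / (qpoch q a * qpoch q b)"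
  by (simp add: qbin_def)

context
  fixes q :: real
  assumes q: "0 < q" "q < 1"
begin

lemma qbin_bounds: "0 \<le> qbin q n k" "qbin q n k \<le> 1 / (euler q)\<^sup>2"
proof -
  note pos = qpoch_pos[OF q] euler_pos[OF q]
  show "0 \<le> qbin q n k" using pos by (auto simp: qbin_def intro!: divide_nonneg_nonneg mult_nonneg_nonneg less_imp_le)
  have "qpoch q n / (qpoch q (nat k) * qpoch q (n - nat k)) \<le> 1 / (euler q * euler q)"
    using pos euler_le_qfac[OF q] qpoch_antimono[OF q, of 0 n] less_imp_le[OF pos(1)] less_imp_le[OF pos(2)]
    by (intro frac_le mult_mono mult_pos_pos) (auto simp: qpoch_def[of _ 0])
  then show "qbin q n k \<le> 1 / (euler q)\<^sup>2" using pos by (auto simp: qbin_def power2_eq_square)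
qed

text \<open>Together with the uniform bound above, this is what carries the finite triple product to the infinite
  one.\<close>

lemma qbin_lim: "(\<lambda>n. qbin q (n + n) (int n + j)) \<longlonglongrightarrow> 1 / euler q"
proof -
  have ev: "\<forall>\<^sub>F n in sequentially. qpoch q (n + n) / (qpoch q (nat (int n + j)) * qpoch q (nat (int n - j)))
      = qbin q (n + n) (int n + j)"
    using eventually_ge_at_top[of "nat \<bar>j\<bar>"]
  proof eventually_elim
    case (elim n)
    then have "n + n - nat (int n + j) = nat (int n - j)" by auto
    with elim show ?case by (auto simp: qbin_def)
  qed
  have l1: "filterlim (\<lambda>n::nat. n + n) at_top sequentially"
    by (rule filterlim_at_top_mono[OF filterlim_ident]) auto
  have "filterlim (\<lambda>n. nat (int n + i)) at_top sequentially" for i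
    unfolding filterlim_at_top
  proof
    fix Z show "\<forall>\<^sub>F n in sequentially. Z \<le> nat (int n + i)"
      using eventually_ge_at_top[of "Z + nat \<bar>i\<bar>"] by eventually_elim auto
  qed
  from this[of j] this[of "-j"] have l2: "filterlim (\<lambda>n. nat (int n + j)) at_top sequentially" 
     "filterlim (\<lambda>n. nat (int n - j)) at_top sequentially" by auto
  note c = filterlim_compose[OF qpoch_lim[OF q]]
  have "(\<lambda>n. qpoch q (n + n) / (qpoch q (nat (int n + j)) * qpoch q (nat (int n - j))))
     \<longlonglongrightarrow> euler q / (euler q * euler q)"
    by (intro tendsto_divide tendsto_mult c l1 l2) (use euler_pos[OF q] in auto)
  then show ?thesis using euler_pos[OF q] tendsto_cong[OF ev] by simp
qed

lemma qbin_Suc1: "qbin q (Suc n) k = qbin q n k + q powi (int n + 1 - k) * qbin q n (k - 1)"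
  and qbin_Suc2: "qbin q (Suc n) k = q powi k * qbin q n k + qbin q n (k - 1)"
proof -
  note pos = qpoch_pos[OF q] 
  have nz: "qpoch q n \<noteq> 0" "1 - q ^ Suc n \<noteq> 0" "1 - q * q ^ n \<noteq> 0" for n 
    using pos[of n] one_minus_power_bounds(1)[OF q, of n] by auto
  consider "k < 0 \<or> k > int n + 1" | "k = 0" | "k = int n + 1" | a b where "k = int (Suc a)" "n = Suc a + b"
  proof -
    have "\<exists>a b. k = int (Suc a) \<and> n = Suc a + b" if "0 < k" "k \<le> int n"
      using that by (intro exI[of _ "nat k - 1"] exI[of _ "n - nat k"]) auto
    then show thesis using that by force
  qed
  then have "qbin q (Suc n) k = qbin q n k + q powi (int n + 1 - k) * qbin q n (k - 1)
     \<and> qbin q (Suc n) k = q powi k * qbin q n k + qbin q n (k - 1)"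
  proof cases
    case 4
    have 1: "qbin q (Suc n) k = qpoch q (a + b) * (1 - q ^ Suc (a + b)) * (1 - q ^ Suc (Suc (a + b))) / 
        (qpoch q a * (1 - q ^ Suc a) * (qpoch q b * (1 - q ^ Suc b)))"
      using qbin_eq[of q "Suc a" "Suc b"] 4 by (simp only: qpoch_Suc add_Suc add_Suc_right)
    have 2: "qbin q n k = qpoch q (a + b) * (1 - q ^ Suc (a + b)) / 
        (qpoch q a * (1 - q ^ Suc a) * qpoch q b)"
      using qbin_eq[of q "Suc a" "b"] 4 by (simp only: qpoch_Suc add_Suc add_Suc_right)
    have 3: "qbin q n (k - 1) = qpoch q (a + b) * (1 - q ^ Suc (a + b)) / 
        (qpoch q a * (qpoch q b * (1 - q ^ Suc b)))"
      using qbin_eq[of q "a" "Suc b"] 4 by (simp add: qpoch_Suc del: power_Suc)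
    have "int n + 1 - k = int (Suc b)" "k = int (Suc a)" using 4 by simp_all
    then have 4: "q powi (int n + 1 - k) = q ^ Suc b" "q powi k = q ^ Suc a"
      by (simp_all only: power_int_of_nat)
    show ?thesis unfolding 1 2 3 4 using nz[of a] nz[of b]
      by (simp add: divide_simps) (simp add: algebra_simps power_add)
  next
    case 3
    then have "nat k = Suc n" "nat (k - 1) = n" by auto
    with 3 pos[of "Suc n"] pos[of n] pos[of 0] show ?thesis
      by (auto simp: qbin_def qpoch_def[of _ 0] simp flip: of_nat_Suc)
  next
    case 2
    with pos[of "Suc n"] pos[of n] pos[of 0] show ?thesis
      by (auto simp: qbin_def qpoch_def[of _ 0])
  qed (auto simp: qbin_def)
  then show "qbin q (Suc n) k = qbin q n k + q powi (int n + 1 - k) * qbin q n (k - 1)"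
    "qbin q (Suc n) k = q powi k * qbin q n k + qbin q n (k - 1)" by auto
qed

end

section \<open>Jacobi's triple product with weights\<close>

text \<open>For a Laurent series with coefficients \<open>c\<close> in \<open>w ^ j\<close> (the powers being part of
  \<open>c\<close>), these are its value and its first two derivatives under \<open>w d/dw\<close>.\<close>

definition jet :: "(int \<Rightarrow> real) \<Rightarrow> real \<Rightarrow> real \<Rightarrow> real \<Rightarrow> bool" where
  "jet c s0 s1 s2 \<longleftrightarrow> (c has_sum s0) UNIV \<and> ((\<lambda>j. of_int j * c j) has_sum s1) UNIV
     \<and> ((\<lambda>j. of_int j ^ 2 * c j) has_sum s2) UNIV"

lemma has_sum_shift:
  fixes c :: "int \<Rightarrow> real"
  shows "(c has_sum s) UNIV \<Longrightarrow> ((\<lambda>j. c (j + d)) has_sum s) UNIV"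
  by (subst has_sum_reindex_bij_betw[of "\<lambda>j. j + d" UNIV UNIV c]) (auto intro!: bij_betwI[of _ _ _ "\<lambda>j. j - d"])

text \<open>Multiplying a Laurent series in \<open>w\<close> by \<open>1 + x\<close>, where \<open>x\<close> is a
  constant times \<open>w\<close>, moves coefficients up by one index. The formulas for the new value and derivatives
  are the Leibniz rule, as \<open>w d/dw\<close> maps \<open>1 + x\<close> to \<open>x\<close>.\<close>

lemma jet_times_up:
  assumes "jet c s0 s1 s2"
  shows "jet (\<lambda>j. c j + x * c (j - 1)) ((1 + x) * s0) ((1 + x) * s1 + x * s0)
           ((1 + x) * s2 + 2 * x * s1 + x * s0)"
proof -
  have s: "(c has_sum s0) UNIV" "((\<lambda>j. of_int j * c j) has_sum s1) UNIV"
     "((\<lambda>j. of_int j ^ 2 * c j) has_sum s2) UNIV" using assms by (auto simp: jet_def)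
  note t = s[THEN has_sum_shift[where d = "-1"]]
  note u = has_sum_cmult_right[OF t(1), of x] has_sum_cmult_right[OF t(2), of x] has_sum_cmult_right[OF t(3), of x]
  have 0: "((\<lambda>j. c j + x * c (j - 1)) has_sum (s0 + x * s0)) UNIV"
    using has_sum_add[OF s(1) u(1)] by simp
  have 1: "((\<lambda>j. of_int j * (c j + x * c (j - 1))) has_sum (s1 + (x * s1 + x * s0))) UNIV"
    using has_sum_add[OF s(2) has_sum_add[OF u(2) u(1)]] by (simp add: algebra_simps)
  have 2: "((\<lambda>j. of_int j ^ 2 * (c j + x * c (j - 1))) has_sum (s2 + (x * s2 + (2 * (x * s1) + x * s0)))) UNIV"
    using has_sum_add[OF s(3) has_sum_add[OF u(3) has_sum_add[OF has_sum_cmult_right[OF u(2), of 2] u(1)]]] 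
    by (simp add: algebra_simps power2_eq_square)
  show ?thesis using 0 1 2 unfolding jet_def by (simp add: algebra_simps)
qed

text \<open>Here \<open>x\<close> is a constant times \<open>1 / w\<close>, and \<open>w d/dw\<close> maps
  \<open>1 + x\<close> to \<open>- x\<close>.\<close>

lemma jet_times_down:
  assumes "jet c s0 s1 s2"
  shows "jet (\<lambda>j. c j + x * c (j + 1)) ((1 + x) * s0) ((1 + x) * s1 - x * s0)
           ((1 + x) * s2 - 2 * x * s1 + x * s0)"
proof -
  have s: "(c has_sum s0) UNIV" "((\<lambda>j. of_int j * c j) has_sum s1) UNIV"
     "((\<lambda>j. of_int j ^ 2 * c j) has_sum s2) UNIV" using assms by (auto simp: jet_def)
  note t = s[THEN has_sum_shift[where d = "1"]]
  note u = has_sum_cmult_right[OF t(1), of x] has_sum_cmult_right[OF t(2), of x] has_sum_cmult_right[OF t(3), of x]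
  have 0: "((\<lambda>j. c j + x * c (j + 1)) has_sum (s0 + x * s0)) UNIV"
    using has_sum_add[OF s(1) u(1)] by simp
  have 1: "((\<lambda>j. of_int j * (c j + x * c (j + 1))) has_sum (s1 + (x * s1 + (-1) * (x * s0)))) UNIV"
    using has_sum_add[OF s(2) has_sum_add[OF u(2) has_sum_cmult_right[OF u(1), of "-1"]]] by (simp add: algebra_simps)
  have 2: "((\<lambda>j. of_int j ^ 2 * (c j + x * c (j + 1))) has_sum (s2 + (x * s2 + ((-2) * (x * s1) + x * s0)))) UNIV"
    using has_sum_add[OF s(3) has_sum_add[OF u(3) has_sum_add[OF has_sum_cmult_right[OF u(2), of "-2"] u(1)]]] 
    by (simp add: algebra_simps power2_eq_square)
  show ?thesis using 0 1 2 unfolding jet_def by (simp add: algebra_simps)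
qed

text \<open>The term of index \<open>j\<close> in the expansion of the product of \<open>1 + w * q ^ k\<close> for
  \<open>k < M\<close> and \<open>1 + q ^ Suc k / w\<close> for \<open>k < N\<close>. Two separate bounds allow one
  factor to be attached at a time.\<close>

definition jtp_coeff :: "real \<Rightarrow> real \<Rightarrow> nat \<Rightarrow> nat \<Rightarrow> int \<Rightarrow> real" where
  "jtp_coeff q w M N j = w powi j * q powi tri j * qbin q (M + N) (int N + j)"

text \<open>The two Pascal rules are exactly the effect of one more factor of either kind.\<close>

lemma jtp_coeff_Suc1:
  assumes q: "0 < q" "q < 1" "w \<noteq> 0"
  shows "jtp_coeff q w (Suc M) N = (\<lambda>j. jtp_coeff q w M N j + (w * q ^ M) * jtp_coeff q w M N (j - 1))"
proof
  fix j
  have 1: "w powi j = w * w powi (j - 1)" using q by (simp add: power_int_diff)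
  have "q powi tri j * q powi (int M + 1 - j) = q ^ M * q powi tri (j - 1)"
    using q tri_add1[of "j - 1"] by (simp add: add.commute flip: power_int_add power_int_of_nat)
  then show "jtp_coeff q w (Suc M) N j = jtp_coeff q w M N j + (w * q ^ M) * jtp_coeff q w M N (j - 1)"
    using qbin_Suc1[OF q(1,2), of "M + N" "int N + j"] 1 q
    by (simp add: jtp_coeff_def algebra_simps)
qed

lemma jtp_coeff_Suc2:
  assumes q: "0 < q" "q < 1" "w \<noteq> 0"
  shows "jtp_coeff q w M (Suc N) = (\<lambda>j. jtp_coeff q w M N j + (q ^ Suc N / w) * jtp_coeff q w M N (j + 1))"
proof
  fix j
  have 1: "w powi j = w powi (j + 1) / w" using q by (simp add: power_int_add)
  have "q powi tri j * q powi (int N + 1 + j) = q ^ Suc N * q powi tri (j + 1)"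
    using q tri_add1[of "j"] by (simp add: add_ac flip: power_int_add power_int_of_nat power_Suc)
  then show "jtp_coeff q w M (Suc N) j = jtp_coeff q w M N j + (q ^ Suc N / w) * jtp_coeff q w M N (j + 1)"
    using qbin_Suc2[OF q(1,2), of "M + N" "int N + 1 + j"] 1 q
    by (simp add: jtp_coeff_def algebra_simps)
qed

lemma jet_jtp_coeff_00: "jet (jtp_coeff q w 0 0) 1 0 0"
proof -
  have "((\<lambda>j. of_int j ^ i * jtp_coeff q w 0 0 j) has_sum (0 ^ i)) UNIV" for i
    by (rule has_sum_finite_neutralI[of "{0}"]) (auto simp: jtp_coeff_def qbin_def qpoch_def tri_def)
  from this[of 0] this[of 1] this[of 2] show ?thesis by (simp add: jet_def)
qed

definition jtp_prod :: "real \<Rightarrow> real \<Rightarrow> nat \<Rightarrow> real" where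
  "jtp_prod q w n = (\<Prod>k<n. (1 + w * q ^ k) * (1 + q ^ Suc k / w))"

text \<open>Partial sums of the second derivative, under \<open>w d/dw\<close>, of the logarithm of the infinite
  product.\<close>

definition lambert_sum :: "real \<Rightarrow> real \<Rightarrow> nat \<Rightarrow> real" where
  "lambert_sum q w n =
     (\<Sum>k<n. w * q ^ k / (1 + w * q ^ k)\<^sup>2 + (q ^ Suc k / w) / (1 + q ^ Suc k / w)\<^sup>2)"

lemma jet_imp_infsum:
  assumes "jet c s0 s1 s2"
  shows "infsum c UNIV = s0" "(\<Sum>\<^sub>\<infinity>j. of_int j * c j) = s1" "(\<Sum>\<^sub>\<infinity>j. of_int j ^ 2 * c j) = s2"
  using assms by (auto simp: jet_def intro: infsumI)

context
  fixes q w :: real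
  assumes q: "0 < q" "q < 1" and w: "w \<noteq> 0"
begin

lemma jtp_coeff_lim:
  assumes "i \<le> 2"
  shows "(\<lambda>n. \<Sum>\<^sub>\<infinity>j. of_int j ^ i * jtp_coeff q w n n j) \<longlonglongrightarrow> theta i q w / euler q"
proof -
  let ?t = "\<lambda>j. of_int j ^ i * w powi j * q powi tri j"
  have sm: "(\<lambda>j. \<bar>?t j\<bar>) summable_on UNIV"
    using theta_summable[OF q w assms, THEN summable_on_iff_abs_summable_on_real[THEN iffD1]] by (simp only: real_norm_def)
  have "(\<lambda>n. \<Sum>\<^sub>\<infinity>j. of_int j ^ i * jtp_coeff q w n n j) \<longlonglongrightarrow> (\<Sum>\<^sub>\<infinity>j. ?t j * (1 / euler q))"
  proof (rule tendsto_infsum_dominated[where h = "\<lambda>j. \<bar>?t j\<bar> * (1 / (euler q)\<^sup>2)"])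
    fix j
    show "(\<lambda>n. of_int j ^ i * jtp_coeff q w n n j) \<longlonglongrightarrow> ?t j * (1 / euler q)"
      using tendsto_mult[OF tendsto_const[of "?t j"] qbin_lim[OF q, of j]]
      by (simp add: jtp_coeff_def mult.assoc)
    fix n
    have "\<bar>of_int j ^ i * jtp_coeff q w n n j\<bar> = \<bar>?t j\<bar> * qbin q (n + n) (int n + j)"
      using qbin_bounds(1)[OF q] by (simp add: jtp_coeff_def abs_mult)
    also have "\<dots> \<le> \<bar>?t j\<bar> * (1 / (euler q)\<^sup>2)"
      using qbin_bounds(2)[OF q] by (intro mult_left_mono) auto
    finally show "\<bar>of_int j ^ i * jtp_coeff q w n n j\<bar> \<le> \<bar>?t j\<bar> * (1 / (euler q)\<^sup>2)" .
  next
    show "(\<lambda>j. \<bar>?t j\<bar> * (1 / (euler q)\<^sup>2)) summable_on UNIV"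
      using sm by (rule summable_on_cmult_left)
  qed
  also have "(\<Sum>\<^sub>\<infinity>j. ?t j * (1 / euler q)) = theta i q w / euler q"
    unfolding theta_def by (subst infsum_cmult_left') simp
  finally show ?thesis .
qed

text \<open>For \<open>f\<close> with value \<open>s0\<close> and derivatives \<open>s1\<close>, \<open>s2\<close> the
  quantity \<open>s0 * s2 - s1\<^sup>2\<close> is \<open>s0\<^sup>2\<close> times the second logarithmic derivative. It
  is therefore additive over the factors after division by \<open>s0\<^sup>2\<close>, and a factor \<open>1 + x\<close>
  contributes \<open>x / (1 + x)\<^sup>2\<close> whether \<open>x\<close> is a multiple of \<open>w\<close> or of
  \<open>1 / w\<close>.\<close>

lemma jet_jtp_coeff: "\<exists>s1 s2. jet (jtp_coeff q w n n) (jtp_prod q w n) s1 s2 \<and>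
  ((\<forall>k. 1 + w * q ^ k \<noteq> 0 \<and> 1 + q ^ Suc k / w \<noteq> 0) \<longrightarrow>
     jtp_prod q w n * s2 - s1\<^sup>2 = (jtp_prod q w n)\<^sup>2 * lambert_sum q w n)"
proof (induction n)
  case 0
  show ?case using jet_jtp_coeff_00[of q w]
    by (intro exI[of _ 0]) (simp add: jtp_prod_def lambert_sum_def)
next
  case (Suc n)
  then obtain s1 s2 where j: "jet (jtp_coeff q w n n) (jtp_prod q w n) s1 s2"
    and V: "(\<forall>k. 1 + w * q ^ k \<noteq> 0 \<and> 1 + q ^ Suc k / w \<noteq> 0) \<longrightarrow>
     jtp_prod q w n * s2 - s1\<^sup>2 = (jtp_prod q w n)\<^sup>2 * lambert_sum q w n" by blast
  define x where "x = w * q ^ n"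
  define y where "y = q ^ Suc n / w"
  define s0 where "s0 = jtp_prod q w n"
  have prod: "jtp_prod q w (Suc n) = (1 + y) * ((1 + x) * s0)"
    by (simp add: jtp_prod_def s0_def x_def y_def)
  have lam: "lambert_sum q w (Suc n) = lambert_sum q w n + (x / (1 + x)\<^sup>2 + y / (1 + y)\<^sup>2)"
    by (simp add: lambert_sum_def x_def y_def)
  note j1 = jet_times_up[OF j, of x, folded s0_def]
  have j2: "jet (jtp_coeff q w (Suc n) n) ((1 + x) * s0) ((1 + x) * s1 + x * s0) ((1 + x) * s2 + 2 * x * s1 + x * s0)"
    using j1 jtp_coeff_Suc1[OF q w, of n n] by (simp add: x_def)
  let ?u1 = "(1 + y) * ((1 + x) * s1 + x * s0) - y * ((1 + x) * s0)"
  let ?u2 = "(1 + y) * ((1 + x) * s2 + 2 * x * s1 + x * s0) - 2 * y * ((1 + x) * s1 + x * s0) + y * ((1 + x) * s0)"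
  have "jet (jtp_coeff q w (Suc n) (Suc n)) ((1 + y) * ((1 + x) * s0)) ?u1 ?u2"
    using jet_times_down[OF j2, of y] jtp_coeff_Suc2[OF q w, of "Suc n" n] by (simp add: y_def)
  moreover have "(1 + y) * ((1 + x) * s0) * ?u2 - ?u1\<^sup>2 = ((1 + y) * ((1 + x) * s0))\<^sup>2 * lambert_sum q w (Suc n)"
    if nv: "\<forall>k. 1 + w * q ^ k \<noteq> 0 \<and> 1 + q ^ Suc k / w \<noteq> 0"
  proof -
    have nz: "1 + x \<noteq> 0" "1 + y \<noteq> 0" using nv by (auto simp: x_def y_def)
    have v: "s0 * s2 - s1\<^sup>2 = s0\<^sup>2 * lambert_sum q w n" using V nv s0_def by blast
    have "(1 + y) * ((1 + x) * s0) * ?u2 - ?u1\<^sup>2 =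
       (1 + y)\<^sup>2 * (1 + x)\<^sup>2 * (s0 * s2 - s1\<^sup>2) + s0\<^sup>2 * ((1 + y)\<^sup>2 * x + (1 + x)\<^sup>2 * y)"
      by (simp add: power2_eq_square algebra_simps)
    also have "\<dots> = ((1 + y) * ((1 + x) * s0))\<^sup>2 * lambert_sum q w (Suc n)"
      unfolding v lam power_mult_distrib using nz by (simp add: field_simps)
    finally show ?thesis .
  qed
  ultimately show ?case unfolding prod by blast
qed

text \<open>The product on the left is the one without the factors \<open>1 - q ^ k\<close>, whence the division by
  \<open>euler q\<close>.\<close>

theorem jacobi_triple_product: "jtp_prod q w \<longlonglongrightarrow> theta 0 q w / euler q"
proof -
  have "(\<Sum>\<^sub>\<infinity>j. of_int j ^ 0 * jtp_coeff q w n n j) = jtp_prod q w n" for n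
    using jet_jtp_coeff[of n] jet_imp_infsum by auto
  then show ?thesis using jtp_coeff_lim[of 0] by simp
qed

text \<open>The condition \<open>nv\<close> keeps \<open>w\<close> away from the zeros of the product, where the
  logarithmic derivative has poles.\<close>

lemma theta_log_derivative:
  assumes nv: "\<forall>k. 1 + w * q ^ k \<noteq> 0 \<and> 1 + q ^ Suc k / w \<noteq> 0"
    and lam: "lambert_sum q w \<longlonglongrightarrow> L"
  shows "theta 0 q w * theta 2 q w - (theta 1 q w)\<^sup>2 = (theta 0 q w)\<^sup>2 * L"
proof -
  define S where "S i n = (\<Sum>\<^sub>\<infinity>j. of_int j ^ i * jtp_coeff q w n n j)" for i n
  have S: "S i \<longlonglongrightarrow> theta i q w / euler q" if "i \<le> 2" for i
    using jtp_coeff_lim[OF that] by (simp add: S_def[abs_def])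
  have eq: "S 0 n * S 2 n - (S 1 n)\<^sup>2 = (S 0 n)\<^sup>2 * lambert_sum q w n" for n
    using jet_jtp_coeff[of n] nv jet_imp_infsum by (auto simp: S_def)
  have "(\<lambda>n. S 0 n * S 2 n - (S 1 n)\<^sup>2) \<longlonglongrightarrow>
     theta 0 q w / euler q * (theta 2 q w / euler q) - (theta 1 q w / euler q)\<^sup>2"
    by (intro tendsto_intros S) auto
  moreover have "(\<lambda>n. (S 0 n)\<^sup>2 * lambert_sum q w n) \<longlonglongrightarrow> (theta 0 q w / euler q)\<^sup>2 * L"
    by (intro tendsto_intros S lam) auto
  ultimately have "theta 0 q w / euler q * (theta 2 q w / euler q) - (theta 1 q w / euler q)\<^sup>2
     = (theta 0 q w / euler q)\<^sup>2 * L"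
    unfolding eq by (rule LIMSEQ_unique)
  then show ?thesis using euler_pos[OF q] by (simp add: field_simps power2_eq_square)
qed

end

text \<open>At \<open>w = -1\<close> the factor for \<open>k = 0\<close> vanishes, so the derivative is, up to the sign,
  the product of the remaining factors. The second claim is the identity of Jacobi for the cube of the Euler
  product.\<close>

lemma theta_at_minus_one:
  assumes q: "0 < q" "q < 1"
  shows "theta 0 q (-1) = 0" "theta 1 q (-1) = - (euler q ^ 3)"
proof -
  have w: "-1 \<noteq> (0::real)" by simp
  \<comment> \<open>Once the value is 0, a further factor \<open>1 + x\<close> just multiplies the first derivative by
    \<open>1 + x\<close>.\<close>
  have 1: "\<exists>s2. jet (jtp_coeff q (-1) (Suc m) 0) 0 (- qpoch q m) s2" for m
  proof (induction m)
    case 0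
    show ?case using jet_times_up[OF jet_jtp_coeff_00[of q "-1"], of "-1"] jtp_coeff_Suc1[OF q w, of 0 0]
      by (auto simp: qpoch_def)
  next
    case (Suc m)
    then obtain s2 where "jet (jtp_coeff q (-1) (Suc m) 0) 0 (- qpoch q m) s2" by blast
    from jet_times_up[OF this, of "- 1 * q ^ Suc m"] jtp_coeff_Suc1[OF q w, of "Suc m" 0] 
    show ?case by (auto simp: qpoch_Suc algebra_simps)
  qed
  have 2: "\<exists>s2. jet (jtp_coeff q (-1) (Suc m) n) 0 (- qpoch q m * qpoch q n) s2" for m n
  proof (induction n)
    case 0
    show ?case using 1 by (auto simp: qpoch_def[of _ 0])
  next
    case (Suc n)
    then obtain s2 where "jet (jtp_coeff q (-1) (Suc m) n) 0 (- qpoch q m * qpoch q n) s2" by blast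
    from jet_times_down[OF this, of "q ^ Suc n / - 1"] jtp_coeff_Suc2[OF q w, of "Suc m" n] 
    show ?case by (auto simp: qpoch_Suc algebra_simps)
  qed
  have 3: "(\<Sum>\<^sub>\<infinity>j. of_int j ^ 0 * jtp_coeff q (-1) (Suc n) (Suc n) j) = 0"
     "(\<Sum>\<^sub>\<infinity>j. of_int j ^ 1 * jtp_coeff q (-1) (Suc n) (Suc n) j) = - qpoch q n * qpoch q (Suc n)" for n
    using 2[of n "Suc n"] jet_imp_infsum by auto
  have "(\<lambda>n. 0) \<longlonglongrightarrow> theta 0 q (-1) / euler q"
    using LIMSEQ_Suc[OF jtp_coeff_lim[OF q w, of 0]] unfolding 3 by simp
  then show "theta 0 q (-1) = 0" using euler_pos[OF q] LIMSEQ_unique[OF tendsto_const] by fastforce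
  have "(\<lambda>n. - qpoch q n * qpoch q (Suc n)) \<longlonglongrightarrow> theta 1 q (-1) / euler q"
    using LIMSEQ_Suc[OF jtp_coeff_lim[OF q w, of 1]] unfolding 3 by simp
  moreover have "(\<lambda>n. - qpoch q n * qpoch q (Suc n)) \<longlonglongrightarrow> - euler q * euler q"
    by (intro tendsto_intros qpoch_lim[OF q] LIMSEQ_Suc)
  ultimately have "theta 1 q (-1) / euler q = - euler q * euler q" by (rule LIMSEQ_unique)
  then show "theta 1 q (-1) = - (euler q ^ 3)" 
    using euler_pos[OF q] by (simp add: field_simps power3_eq_cube)
qed

section \<open>The difference formula of Weierstrass\<close>

text \<open>Up to a power of \<open>x\<close> these are, in the variable \<open>x\<^sup>2\<close> times a power of
  \<open>q\<close>, theta series with \<open>q\<^sup>2\<close> in place of \<open>q\<close>; they span the space of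
  theta functions of degree two that contains \<open>theta 0 q (w * x) * theta 0 q (w / x)\<close> as a function of
  \<open>x\<close>. The index \<open>i\<close> again counts derivatives under \<open>x d/dx\<close>.\<close>

definition even_theta :: "nat \<Rightarrow> real \<Rightarrow> real \<Rightarrow> real" where
  "even_theta i q x = (\<Sum>\<^sub>\<infinity>v. of_int (2 * v) ^ i * (x powi (2 * v) * q powi (v * v)))"

definition odd_theta :: "nat \<Rightarrow> real \<Rightarrow> real \<Rightarrow> real" where
  "odd_theta i q x = (\<Sum>\<^sub>\<infinity>v. of_int (2 * v + 1) ^ i * (x powi (2 * v + 1) * q powi (v * v + v)))"

context
  fixes q :: real
  assumes q: "0 < q" "q < 1"
begin

lemma theta_has_sum:
  assumes "w \<noteq> 0" "i \<le> 2"
  shows "((\<lambda>j. of_int j ^ i * w powi j * q powi tri j) has_sum theta i q w) UNIV"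
  unfolding theta_def using theta_summable[OF q assms] by simp

lemma theta_pos: "w > 0 \<Longrightarrow> theta 0 q w > 0"
proof -
  assume w: "w > 0"
  have "(\<lambda>j. w powi j * q powi tri j) summable_on UNIV" using theta_summable[OF q, of w 0] w by simp
  then have "(\<Sum>j\<in>{0}. w powi j * q powi tri j) \<le> (\<Sum>\<^sub>\<infinity>j. w powi j * q powi tri j)"
    by (intro finite_sum_le_infsum) (use q w in auto)
  then show ?thesis by (simp add: theta_def tri_def)
qed

lemma even_theta_summable:
  assumes x: "x \<noteq> 0" and i: "i \<le> 2"
  shows "(\<lambda>v. of_int (2 * v) ^ i * (x powi (2 * v) * q powi (v * v))) summable_on UNIV"
proof -
  have q2: "0 < q\<^sup>2" "q\<^sup>2 < 1" using q by (auto simp: power_less_one_iff)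
  have eq: "of_int (2 * v) ^ i * (x powi (2 * v) * q powi (v * v))
     = 2 ^ i * (of_int v ^ i * (x\<^sup>2 * q) powi v * (q\<^sup>2) powi tri v)" for v
  proof -
    have "(x\<^sup>2) powi v = x powi (2 * v)" "(q\<^sup>2) powi tri v = q powi (2 * tri v)"
      by (simp_all add: power_int_mult)
    moreover have "q powi (v * v) = q powi v * q powi (2 * tri v)" 
      using q two_tri[of v] by (simp flip: power_int_add) (simp add: algebra_simps)
    ultimately show ?thesis
      by (simp add: power_mult_distrib power_int_mult_distrib)
  qed
  show ?thesis unfolding eq
    by (intro summable_on_cmult_right theta_summable[OF q2 _ i]) (use q x in auto)
qed

lemma odd_theta_summable:
  assumes x: "x \<noteq> 0" and i: "i \<le> 2"
  shows "(\<lambda>v. of_int (2 * v + 1) ^ i * (x powi (2 * v + 1) * q powi (v * v + v))) summable_on UNIV"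
proof -
  have q2: "0 < q\<^sup>2" "q\<^sup>2 < 1" using q by (auto simp: power_less_one_iff)
  have eq: "x powi (2 * v + 1) * q powi (v * v + v) = x * ((x\<^sup>2 * q\<^sup>2) powi v * (q\<^sup>2) powi tri v)" for v
  proof -
    have "(x\<^sup>2) powi v = x powi (2 * v)" "(q\<^sup>2) powi v = q powi (2 * v)" "(q\<^sup>2) powi tri v = q powi (2 * tri v)"
      by (simp_all add: power_int_mult)
    moreover have "q powi (v * v + v) = q powi (2 * v) * q powi (2 * tri v)" 
      using q two_tri[of v] by (simp flip: power_int_add) (simp add: algebra_simps)
    ultimately show ?thesis using x
      by (simp add: power_int_mult_distrib power_int_add)
  qed
  define t where "t i v = of_int v ^ i * (x\<^sup>2 * q\<^sup>2) powi v * (q\<^sup>2) powi tri v" for i v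
  have t: "t i summable_on UNIV" if "i \<le> 2" for i
    unfolding t_def[abs_def] by (intro theta_summable[OF q2 _ that]) (use q x in auto)
  consider "i = 0" | "i = 1" | "i = 2" using i by linarith
  then show ?thesis
  proof cases
    case 1
    show ?thesis unfolding eq using summable_on_cmult_right[OF t[of 0], of x] 1 by (simp add: t_def)
  next
    case 2
    show ?thesis unfolding eq 
      using summable_on_cmult_right[OF summable_on_add[OF summable_on_cmult_right[OF t[of 1], of 2] t[of 0]], of x] 2 
      by (simp add: t_def algebra_simps)
  next
    case 3
    show ?thesis unfolding eq 
      using summable_on_cmult_right[OF summable_on_add[OF summable_on_add[OF 
         summable_on_cmult_right[OF t[of 2], of 4] summable_on_cmult_right[OF t[of 1], of 4]] t[of 0]], of x] 3
      by (simp add: t_def algebra_simps power2_eq_square)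
  qed
qed

lemma theta_shift: "w \<noteq> 0 \<Longrightarrow> theta 0 q (1 / w) = theta 0 q w / w"
proof -
  assume w: "w \<noteq> 0"
  have "theta 0 q (1 / w) = (\<Sum>\<^sub>\<infinity>j. (1 / w) powi (1 - j) * q powi tri (1 - j))"
    unfolding theta_def
    by (rule infsum_reindex_bij_witness[of _ "\<lambda>j. 1 - j" "\<lambda>j. 1 - j"]) auto
  also have "\<dots> = (\<Sum>\<^sub>\<infinity>j. w powi j * q powi tri j * (1 / w))"
    by (rule infsum_cong) (use w in \<open>simp add: tri_one_minus power_int_diff power_int_divide_distrib\<close>)
  also have "\<dots> = theta 0 q w / w"
    unfolding theta_def by (subst infsum_cmult_left') simp
  finally show ?thesis .
qed

lemma theta_reflect: "w \<noteq> 0 \<Longrightarrow> theta 0 q (q / w) = theta 0 q w"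
proof -
  assume w: "w \<noteq> 0"
  have "theta 0 q (q / w) = (\<Sum>\<^sub>\<infinity>j. (q / w) powi (- j) * q powi tri (- j))"
    unfolding theta_def
    by (rule infsum_reindex_bij_witness[of _ "\<lambda>j. - j" "\<lambda>j. - j"]) auto
  also have "\<dots> = theta 0 q w" unfolding theta_def
    by (rule infsum_cong) (use w q in \<open>simp add: tri_minus power_int_add power_int_minus power_int_divide_distrib field_simps\<close>)
  finally show ?thesis .
qed

text \<open>Expand the product over pairs \<open>(m, n)\<close> and use \<open>m + n\<close> and \<open>m - n\<close> as
  new indices. They have equal parity, and each of the two parities gives a product of a sum over \<open>m + n\<close>
  and a sum over \<open>m - n\<close>. The weight \<open>(m - n) ^ i\<close> differentiates with respect to
  \<open>x\<close>.\<close>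

lemma theta_product:
  assumes w: "w \<noteq> 0" and x: "x \<noteq> 0"
    and i: "i \<le> 2"
  shows "((\<lambda>(m, n). of_int (m - n) ^ i * ((w * x) powi m * (w / x) powi n * (q powi tri m * q powi tri n)))
     has_sum w * (odd_theta 0 q w * even_theta i q x + even_theta 0 q w * odd_theta i q x)) UNIV"
proof -
  define F where "F = (\<lambda>(m, n). of_int (m - n) ^ i * ((w * x) powi m * (w / x) powi n * (q powi tri m * q powi tri n)))"
  define E where "E = (\<lambda>v. of_int (2 * v) ^ i * (x powi (2 * v) * q powi (v * v)))"
  define O' where "O' = (\<lambda>v. of_int (2 * v + 1) ^ i * (x powi (2 * v + 1) * q powi (v * v + v)))"
  define A where "A = (\<lambda>v. w powi (2 * v + 1) * q powi (v * v + v))"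
  define B where "B = (\<lambda>v. w powi (2 * v) * q powi (v * v))"
  have A: "A summable_on UNIV" "infsum A UNIV = odd_theta 0 q w"
    using odd_theta_summable[OF w, of 0] by (auto simp: A_def odd_theta_def)
  have B: "B summable_on UNIV" "infsum B UNIV = even_theta 0 q w"
    using even_theta_summable[OF w, of 0] by (auto simp: B_def even_theta_def)
  have E: "E summable_on UNIV" "infsum E UNIV = even_theta i q x"
    using even_theta_summable[OF x i] by (auto simp: E_def even_theta_def)
  have O: "O' summable_on UNIV" "infsum O' UNIV = odd_theta i q x"
    using odd_theta_summable[OF x i] by (auto simp: O'_def odd_theta_def)
  have powF: "F (m, n) = of_int (m - n) ^ i * (w powi (m + n) * x powi (m - n) * q powi (tri m + tri n))" for m n
    using w x q by (simp add: F_def power_int_mult_distrib power_int_divide_distrib power_int_add power_int_diff)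
  have "((\<lambda>(u, v). A u * E v) has_sum odd_theta 0 q w * even_theta i q x) (UNIV \<times> UNIV)"
    using has_sum_mult[OF A(1) E(1)] A E by simp
  then have 1: "((\<lambda>(u, v). w * (A u * E v)) has_sum w * (odd_theta 0 q w * even_theta i q x)) (UNIV \<times> UNIV)"
    using has_sum_cmult_right by (fastforce simp: case_prod_unfold)
  have "((\<lambda>(u, v). B u * O' v) has_sum even_theta 0 q w * odd_theta i q x) (UNIV \<times> UNIV)"
    using has_sum_mult[OF B(1) O(1)] B O by simp
  then have 2: "((\<lambda>(u, v). w * (B u * O' v)) has_sum w * (even_theta 0 q w * odd_theta i q x)) (UNIV \<times> UNIV)"
    using has_sum_cmult_right by (fastforce simp: case_prod_unfold)
  \<comment> \<open>The shift by one in \<open>m + n = 2 u + 2\<close> makes the sum over \<open>u\<close> the odd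
    series, so that the same two series occur for \<open>w\<close> and for \<open>x\<close>.\<close>
  have E_eq: "F (u + v + 1, u - v + 1) = w * (A u * E v)" for u v
  proof -
    have "tri (u + v + 1) + tri (u - v + 1) = (u * u + u) + v * v"
      using two_tri[of "u + v + 1"] two_tri[of "u - v + 1"] by (simp add: algebra_simps)
    then show ?thesis unfolding powF using w x q 
      by (simp add: A_def E_def power_int_add power2_eq_square)
  qed
  have O_eq: "F (u + v + 1, u - v) = w * (B u * O' v)" for u v
  proof -
    have "tri (u + v + 1) + tri (u - v) = u * u + (v * v + v)"
      using two_tri[of "u + v + 1"] two_tri[of "u - v"] by (simp add: algebra_simps)
    moreover have "u + v + 1 - (u - v) = 2 * v + 1" "u + v + 1 + (u - v) = 2 * u + 1" by auto
    ultimately show ?thesis unfolding powF using w x q 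
      by (simp add: B_def O'_def power_int_add)
  qed
  have e: "(F has_sum w * (odd_theta 0 q w * even_theta i q x)) {(m, n). even (m + n)}"
    by (rule has_sum_reindex_bij_witness[where i = "\<lambda>(m, n). ((m + n) div 2 - 1, (m - n) div 2)" and
          j = "\<lambda>(u, v). (u + v + 1, u - v + 1)", THEN iffD1, OF _ _ _ _ _ _ 1])
       (auto simp: E_eq, presburger+)
  have o: "(F has_sum w * (even_theta 0 q w * odd_theta i q x)) {(m, n). odd (m + n)}"
    by (rule has_sum_reindex_bij_witness[where i = "\<lambda>(m, n). ((m + n) div 2, (m - n) div 2)" and
          j = "\<lambda>(u, v). (u + v + 1, u - v)", THEN iffD1, OF _ _ _ _ _ _ 2])
       (auto simp: O_eq, presburger+)
  have "(F has_sum w * (odd_theta 0 q w * even_theta i q x) + w * (even_theta 0 q w * odd_theta i q x)) 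
     ({(m, n). even (m + n)} \<union> {(m, n). odd (m + n)})"
    by (intro has_sum_Un_disjoint e o) auto
  moreover have "{(m, n). even (m + n)} \<union> {(m, n). odd (m + n)} = (UNIV :: (int \<times> int) set)" by auto
  ultimately show ?thesis unfolding F_def by (simp add: distrib_left)
qed

lemma theta_times_theta:
  assumes "w \<noteq> 0" "x \<noteq> 0"
  shows "theta 0 q (w * x) * theta 0 q (w / x)
     = w * (odd_theta 0 q w * even_theta 0 q x + even_theta 0 q w * odd_theta 0 q x)"
proof -
  note s = theta_summable[OF q, of _ 0]
  have "((\<lambda>(m, n). of_int (m - n) ^ 0 * ((w * x) powi m * (w / x) powi n * (q powi tri m * q powi tri n)))
     has_sum theta 0 q (w * x) * theta 0 q (w / x)) (UNIV \<times> UNIV)"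
    using has_sum_mult[OF s[of "w * x"] s[of "w / x"]] assms
    by (simp add: theta_def case_prod_unfold algebra_simps)
  with theta_product[OF assms, of 0] show ?thesis by (auto intro: has_sum_unique)
qed

text \<open>Since \<open>(m - n)\<^sup>2 = m\<^sup>2 - 2 m n + n\<^sup>2\<close>, the weighted product at
  \<open>x = 1\<close> is the second logarithmic derivative cleared of denominators.\<close>

lemma theta_log_second:
  assumes w: "w \<noteq> 0"
  shows "2 * (theta 0 q w * theta 2 q w - (theta 1 q w)\<^sup>2)
     = w * (odd_theta 0 q w * even_theta 2 q 1 + even_theta 0 q w * odd_theta 2 q 1)"
proof -
  note s = theta_summable[OF q w]
  define t where "t i j = of_int j ^ i * w powi j * q powi tri j" for i j
  have p: "((\<lambda>(m, n). t i m * t j n) has_sum theta i q w * theta j q w) (UNIV \<times> UNIV)"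
    if "i \<le> 2" "j \<le> 2" for i j
    using has_sum_mult[OF s[of i] s[of j]] that by (simp add: theta_def t_def)
  have "((\<lambda>(m, n). t 2 m * t 0 n + t 0 m * t 2 n + (-2) * (t 1 m * t 1 n)) has_sum
     theta 2 q w * theta 0 q w + theta 0 q w * theta 2 q w + (-2) * (theta 1 q w * theta 1 q w)) (UNIV \<times> UNIV)"
    using has_sum_add[OF has_sum_add[OF p[of 2 0] p[of 0 2]] has_sum_cmult_right[OF p[of 1 1], of "-2"]]
    by (simp add: case_prod_unfold)
  also have "(\<lambda>(m, n). t 2 m * t 0 n + t 0 m * t 2 n + (-2) * (t 1 m * t 1 n)) =
    (\<lambda>(m, n). of_int (m - n) ^ 2 * ((w * 1) powi m * (w / 1) powi n * (q powi tri m * q powi tri n)))"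
    by (auto simp: t_def fun_eq_iff power2_eq_square algebra_simps)
  finally have "theta 2 q w * theta 0 q w + theta 0 q w * theta 2 q w + (-2) * (theta 1 q w * theta 1 q w)
    = w * (odd_theta 0 q w * even_theta 2 q 1 + even_theta 0 q w * odd_theta 2 q 1)"
    using theta_product[OF w, of 1 2] by (auto intro: has_sum_unique)
  then show ?thesis by (simp add: power2_eq_square)
qed

lemma even_theta_minus: "even_theta i q (- x) = even_theta i q x"
  by (simp add: even_theta_def power_int_mult)

lemma odd_theta_minus: "x \<noteq> 0 \<Longrightarrow> odd_theta i q (- x) = - odd_theta i q x"
  by (simp add: odd_theta_def power_int_add power_int_mult flip: infsum_uminus)

text \<open>By the two preceding expansions, \<open>V\<close> and \<open>(theta 0 q w)\<^sup>2\<close> have the form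
  \<open>w * (a * odd_theta 0 q w + b * even_theta 0 q w)\<close> with constants \<open>a\<close> and \<open>b\<close>.
  The left-hand side is a determinant, hence, up to a monomial, the constant determinant \<open>K\<close> times the one
  formed from \<open>odd_theta\<close> and \<open>even_theta\<close> at \<open>w\<close> and \<open>u\<close>, and that
  one is \<open>theta 0 q (w * x) * theta 0 q (w / x)\<close> at \<open>x = - u\<close>.\<close>

theorem weierstrass_difference:
  assumes w: "w \<noteq> 0" and u: "u \<noteq> 0"
  defines "V \<equiv> \<lambda>w. theta 0 q w * theta 2 q w - (theta 1 q w)\<^sup>2"
  shows "V u * (theta 0 q w)\<^sup>2 - V w * (theta 0 q u)\<^sup>2
     = u * (theta 1 q (-1))\<^sup>2 * theta 0 q (- (w * u)) * theta 0 q (- (w / u))"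
proof -
  define K where "K = even_theta 2 q 1 * odd_theta 0 q 1 - odd_theta 2 q 1 * even_theta 0 q 1"
  have key: "2 * (V u * (theta 0 q w)\<^sup>2 - V w * (theta 0 q u)\<^sup>2)
     = - (u * K) * theta 0 q (- (w * u)) * theta 0 q (- (w / u))"
    if w: "w \<noteq> 0" and u: "u \<noteq> 0" for w u
  proof -
    have V: "2 * V w = w * (odd_theta 0 q w * even_theta 2 q 1 + even_theta 0 q w * odd_theta 2 q 1)" 
      if "w \<noteq> 0" for w using theta_log_second[OF that] by (simp add: V_def)
    have sq: "(theta 0 q w)\<^sup>2 = w * (odd_theta 0 q w * even_theta 0 q 1 + even_theta 0 q w * odd_theta 0 q 1)" 
      if "w \<noteq> 0" for w using theta_times_theta[OF that, of 1] by (simp add: power2_eq_square)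
    have pr: "theta 0 q (- (w * u)) * theta 0 q (- (w / u))
      = w * (odd_theta 0 q w * even_theta 0 q u - even_theta 0 q w * odd_theta 0 q u)"
      using theta_times_theta[OF w, of "-u"] u by (simp add: even_theta_minus odd_theta_minus)
    have "2 * (V u * (theta 0 q w)\<^sup>2 - V w * (theta 0 q u)\<^sup>2) 
      = (2 * V u) * (theta 0 q w)\<^sup>2 - (2 * V w) * (theta 0 q u)\<^sup>2" by simp
    also have "\<dots> = - (u * K) * (theta 0 q (- (w * u)) * theta 0 q (- (w / u)))"
      unfolding V[OF w] V[OF u] sq[OF w] sq[OF u] pr K_def by algebra
    finally show ?thesis by simp
  qed
  have "theta 0 q 1 > 0" by (rule theta_pos) simp
  \<comment> \<open>The constant is found by putting one point at the zero \<open>-1\<close>, where \<open>V\<close>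
    reduces to the square of the first derivative.\<close>
  moreover have "- 2 * (theta 1 q (-1))\<^sup>2 * (theta 0 q 1)\<^sup>2 = K * (theta 0 q 1)\<^sup>2"
    using key[of 1 "-1"] theta_at_minus_one(1)[OF q] by (simp add: V_def power2_eq_square)
  ultimately have "K = - 2 * (theta 1 q (-1))\<^sup>2"
    by (metis less_irrefl mult_right_cancel power_not_zero)
  with key[OF w u] show ?thesis by simp
qed

end

section \<open>Ramanujan's Lambert series\<close>

definition lambert_term :: "real \<Rightarrow> nat \<Rightarrow> real" where
  "lambert_term q m = q ^ m / (1 - q ^ m)\<^sup>2"

context
  fixes q :: real
  assumes q: "0 < q" "q < 1"
begin

lemma lambert_term_has_sum:
  assumes "m \<ge> 1"
  shows "((\<lambda>d. real d * q ^ (m * d)) has_sum lambert_term q m) {1..}"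
proof -
  have z: "norm (q ^ m) < 1" using q assms by (simp add: power_less_one_iff)
  have "(\<lambda>d. q ^ m * (of_nat (Suc d) * (q ^ m) ^ d)) sums (q ^ m * (1 / (1 - q ^ m)\<^sup>2))"
    by (intro sums_mult geometric_deriv_sums z)
  then have "(\<lambda>d. real (Suc d) * q ^ (m * Suc d)) sums lambert_term q m"
    by (simp add: lambert_term_def power_add mult_ac flip: power_mult)
  then have "((\<lambda>d. real (Suc d) * q ^ (m * Suc d)) has_sum lambert_term q m) UNIV"
    using q by (intro sums_nonneg_imp_has_sum) auto
  then show ?thesis
    by (rule has_sum_reindex_bij_witness[where i = "\<lambda>d. d - 1" and j = Suc, THEN iffD1, rotated 6])
       (auto simp: Suc_le_eq)
qed

lemma summable_lambert_term: "summable (lambert_term q)"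
proof (rule summable_comparison_test')
  show "summable (\<lambda>m. q ^ m * (1 / (1 - q)\<^sup>2))"
    using q by (intro summable_mult2 summable_geometric) auto
  fix m assume "m \<ge> (1::nat)"
  then have "q ^ m \<le> q ^ 1" using q by (intro power_decreasing) auto
  then have "(1 - q)\<^sup>2 \<le> (1 - q ^ m)\<^sup>2" using q by (intro power_mono) auto
  then show "norm (lambert_term q m) \<le> q ^ m * (1 / (1 - q)\<^sup>2)"
    using q \<open>q ^ m \<le> q ^ 1\<close> by (auto simp: lambert_term_def intro!: divide_left_mono mult_pos_pos)
qed

definition chi_lambert :: real where
  "chi_lambert = (\<Sum>m. of_int (chi_5_3 (int m)) * lambert_term q m)"

lemma chi_bound: "\<bar>real_of_int (chi_5_3 k)\<bar> \<le> 1"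
  by (simp add: chi_5_3_def)

lemma summable_chi_lambert: "summable (\<lambda>m. \<bar>of_int (chi_5_3 (int m)) * lambert_term q m\<bar>)"
proof (rule summable_comparison_test'[OF summable_lambert_term])
  fix m
  have "lambert_term q m \<ge> 0" using q by (simp add: lambert_term_def)
  then show "norm \<bar>of_int (chi_5_3 (int m)) * lambert_term q m\<bar> \<le> lambert_term q m"
    using mult_right_mono[OF chi_bound[of "int m"]] by (simp add: abs_mult)
qed

text \<open>In the double series of \<open>\<chi>(m) * d * q ^ (m * d)\<close>, collect the pairs with
  \<open>m * d = n\<close>.\<close>

lemma chi_lambert_has_sum:
  "((\<lambda>n. of_int (sigma1_star chi_5_3 n) * q ^ n) has_sum chi_lambert) {1..}"
proof -
  let ?c = "\<lambda>m::nat. real_of_int (chi_5_3 (int m))"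
  define a where "a = (\<lambda>(m, d). ?c m * (real d * q ^ (m * d)))"
  have in1: "((\<lambda>d. ?c m * (real d * q ^ (m * d))) has_sum ?c m * lambert_term q m) {1..}" if "m \<in> {1..}" for m
    using that by (intro has_sum_cmult_right lambert_term_has_sum) auto
  have in2: "((\<lambda>d. norm (a (m, d))) has_sum \<bar>?c m * lambert_term q m\<bar>) {1..}" if "m \<in> {1..}" for m
  proof -
    have "lambert_term q m \<ge> 0" using q by (simp add: lambert_term_def)
    moreover have "((\<lambda>d. \<bar>?c m\<bar> * (real d * q ^ (m * d))) has_sum \<bar>?c m\<bar> * lambert_term q m) {1..}"
      using that by (intro has_sum_cmult_right lambert_term_has_sum) auto
    ultimately show ?thesis using q by (simp add: a_def abs_mult)
  qed
  have "(\<lambda>p. norm (a p)) summable_on {1..} \<times> {1..}"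
  proof (rule Infinite_Sum.abs_summable_on_Sigma_iff[THEN iffD2], intro conjI ballI)
    show "(\<lambda>d. norm (a (m, d))) summable_on {1..}" if "m \<in> {1..}" for m
      using in2[OF that] by (rule has_sum_imp_summable)
    have "(\<lambda>m. \<bar>?c m * lambert_term q m\<bar>) summable_on UNIV"
      using summable_chi_lambert by (simp add: summable_on_UNIV_nonneg_real_iff)
    then have "(\<lambda>m. \<bar>?c m * lambert_term q m\<bar>) summable_on {1..}"
      by (rule summable_on_subset) auto
    then show "(\<lambda>m. norm (\<Sum>\<^sub>\<infinity>d\<in>{1..}. norm (a (m, d)))) summable_on {1..}"
      by (rule summable_on_cong[THEN iffD1, rotated]) (use in2 infsumI in force)
  qed
  then have asum: "a summable_on {1..} \<times> {1..}" 
    by (rule summable_on_iff_abs_summable_on_real[THEN iffD2])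
  have "((\<lambda>m. ?c m * lambert_term q m) has_sum chi_lambert) UNIV"
    unfolding chi_lambert_def using summable_chi_lambert
    by (intro norm_summable_imp_has_sum[OF _ summable_sums[OF summable_rabs_cancel]]) auto
  then have "((\<lambda>m. ?c m * lambert_term q m) has_sum chi_lambert) {1..}"
    by (rule has_sum_cong_neutral[THEN iffD1, rotated 3]) (auto simp: not_le chi_5_3_def)
  then have "(a has_sum chi_lambert) ({1..} \<times> {1..})"
    by (intro has_sum_SigmaI[OF _ _ asum]) (use in1 in \<open>auto simp: a_def\<close>)
  then have "((\<lambda>(n, d). ?c (n div d) * (real d * q ^ n)) has_sum chi_lambert) (Sigma {1..} (\<lambda>n. {d. d dvd n}))"
    by (rule has_sum_reindex_bij_witness[where i = "\<lambda>(n, d). (n div d, d)" and j = "\<lambda>(m, d). (m * d, d)", THEN iffD1, rotated 6])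
       (auto simp: a_def Suc_le_eq intro!: Nat.gr0I elim!: dvdE)
  then have "((\<lambda>n. \<Sum>d | d dvd n. ?c (n div d) * (real d * q ^ n)) has_sum chi_lambert) {1..}"
    by (rule has_sum_SigmaD) (auto intro!: has_sum_finite)
  then show ?thesis
    by (simp add: sigma1_star_def sum_distrib_right mult.assoc)
qed

lemma block_of_five: "{k * 5..<k * 5 + 5} = {k * 5, k * 5 + 1, k * 5 + 2, k * 5 + 3, k * 5 + (4::nat)}"
  by auto

lemma pow5: "0 < q ^ 5" "q ^ 5 < 1"
  using q by (auto simp: power_less_one_iff)

text \<open>The exponents congruent to 1 and 4 modulo 5 come from \<open>w = - q\<close>, those congruent to 2 and 3
  from \<open>w = - q\<^sup>2\<close>.\<close>

lemma qpoch_five_split: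
  "jtp_prod (q ^ 5) (- q) n * jtp_prod (q ^ 5) (- q\<^sup>2) n * qpoch (q ^ 5) n = qpoch q (n * 5)"
proof -
  have "qpoch q (n * 5) = (\<Prod>m<n. \<Prod>i\<in>{m * 5..<m * 5 + 5}. 1 - q ^ Suc i)"
    unfolding qpoch_def by (rule prod.nat_group[symmetric])
  also have "\<dots> = (\<Prod>m<n. ((1 + (- q) * (q ^ 5) ^ m) * (1 + (q ^ 5) ^ Suc m / (- q))) *
      ((1 + (- q\<^sup>2) * (q ^ 5) ^ m) * (1 + (q ^ 5) ^ Suc m / (- q\<^sup>2))) * (1 - (q ^ 5) ^ Suc m))"
  proof (rule prod.cong[OF refl])
    fix m
    have e: "(- q) * (q ^ 5) ^ m = - (q ^ Suc (m * 5))" "(q ^ 5) ^ Suc m / (- q) = - (q ^ Suc (m * 5 + 3))"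
      "(- q\<^sup>2) * (q ^ 5) ^ m = - (q ^ Suc (m * 5 + 1))" "(q ^ 5) ^ Suc m / (- q\<^sup>2) = - (q ^ Suc (m * 5 + 2))"
      "(q ^ 5) ^ Suc m = q ^ Suc (m * 5 + 4)"
    proof -
      define Q where "Q = q ^ (m * 5)"
      have p: "(q ^ 5) ^ m = Q" "q ^ Suc (m * 5 + i) = Q * q ^ Suc i" for i
        by (simp_all add: Q_def mult.commute[of m] power_mult power_add)
      show "(- q) * (q ^ 5) ^ m = - (q ^ Suc (m * 5))" "(q ^ 5) ^ Suc m / (- q) = - (q ^ Suc (m * 5 + 3))"
        "(- q\<^sup>2) * (q ^ 5) ^ m = - (q ^ Suc (m * 5 + 1))" "(q ^ 5) ^ Suc m / (- q\<^sup>2) = - (q ^ Suc (m * 5 + 2))"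
        "(q ^ 5) ^ Suc m = q ^ Suc (m * 5 + 4)"
        using p(2)[of 0] p(2)[of 1] p(2)[of 2] p(2)[of 3] p(2)[of 4] q 
        by (simp_all only: p(1) power_Suc[of "q ^ 5"] add_0_right) (simp_all add: eval_nat_numeral)
    qed
    show "(\<Prod>i\<in>{m * 5..<m * 5 + 5}. 1 - q ^ Suc i) = ((1 + (- q) * (q ^ 5) ^ m) * (1 + (q ^ 5) ^ Suc m / (- q))) *
      ((1 + (- q\<^sup>2) * (q ^ 5) ^ m) * (1 + (q ^ 5) ^ Suc m / (- q\<^sup>2))) * (1 - (q ^ 5) ^ Suc m)"
      unfolding e(1-4) unfolding e(5) block_of_five by (simp add: mult_ac del: power_Suc)
  qed
  finally show ?thesis by (simp add: jtp_prod_def qpoch_def prod.distrib)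
qed

lemma theta_product_five: "theta 0 (q ^ 5) (- q) * theta 0 (q ^ 5) (- q\<^sup>2) = euler q * euler (q ^ 5)"
proof -
  have "(\<lambda>n. jtp_prod (q ^ 5) (- q) n * jtp_prod (q ^ 5) (- q\<^sup>2) n * qpoch (q ^ 5) n)
     \<longlonglongrightarrow> theta 0 (q ^ 5) (- q) / euler (q ^ 5) * (theta 0 (q ^ 5) (- q\<^sup>2) / euler (q ^ 5)) * euler (q ^ 5)"
    by (intro tendsto_mult jacobi_triple_product[OF pow5] qpoch_lim[OF pow5]) (use q in auto)
  moreover have "(\<lambda>n. qpoch q (n * 5)) \<longlonglongrightarrow> euler q"
    by (rule filterlim_compose[OF qpoch_lim[OF q]]) (rule filterlim_at_top_mono[OF filterlim_ident], auto)
  ultimately have "theta 0 (q ^ 5) (- q) / euler (q ^ 5) * (theta 0 (q ^ 5) (- q\<^sup>2) / euler (q ^ 5)) * euler (q ^ 5) = euler q"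
    unfolding qpoch_five_split by (rule LIMSEQ_unique)
  then show ?thesis using euler_pos[OF pow5] by (simp add: field_simps)
qed

definition residue_sum :: "nat set \<Rightarrow> real" where
  "residue_sum R = (\<Sum>m. if m mod 5 \<in> R then lambert_term q m else 0)"

lemma summable_residue: "summable (\<lambda>m. if m mod 5 \<in> R then lambert_term q m else 0)"
  by (rule summable_comparison_test'[OF summable_lambert_term]) (use q in \<open>auto simp: lambert_term_def\<close>)

text \<open>With nome \<open>q ^ 5\<close> and \<open>w = - (q ^ a)\<close> the terms of the second logarithmic
  derivative are the negatives of the Lambert terms with index congruent to \<open>a\<close> or \<open>- a\<close>
  modulo 5.\<close>

lemma lambert_sum_lim:
  assumes a: "a \<in> {1, 2}"
  shows "lambert_sum (q ^ 5) (- (q ^ a)) \<longlonglongrightarrow> - residue_sum {a, 5 - a}"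
proof -
  let ?f = "\<lambda>m. if m mod 5 \<in> {a, 5 - a} then lambert_term q m else 0"
  have eq: "lambert_sum (q ^ 5) (- (q ^ a)) n = - (\<Sum>m<n * 5. ?f m)" for n
  proof -
    have "(\<Sum>m<n * 5. ?f m) = (\<Sum>k<n. \<Sum>m\<in>{k * 5..<k * 5 + 5}. ?f m)"
      by (rule sum.nat_group[symmetric])
    also have "\<dots> = (\<Sum>k<n. lambert_term q (k * 5 + a) + lambert_term q (k * 5 + (5 - a)))"
    proof (rule sum.cong[OF refl])
      fix k
      have md: "k * 5 mod 5 = 0" "(k * 5 + 1) mod 5 = 1" "(k * 5 + 2) mod 5 = 2" 
        "(k * 5 + 3) mod 5 = 3" "(k * 5 + 4) mod 5 = (4::nat)" by presburger+
      show "(\<Sum>m\<in>{k * 5..<k * 5 + 5}. ?f m) = lambert_term q (k * 5 + a) + lambert_term q (k * 5 + (5 - a))"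
        unfolding block_of_five using a md by (elim insertE emptyE) (simp_all del: One_nat_def add_2_eq_Suc')
    qed
    also have "\<dots> = - lambert_sum (q ^ 5) (- (q ^ a)) n"
    proof -
      have *: "(\<Sum>k<n. g k) = - (\<Sum>k<n. h k)" if "\<And>k. g k = - h k" for g h :: "nat \<Rightarrow> real"
        by (simp add: that sum_negf)
      show ?thesis unfolding lambert_sum_def
      proof (rule *)
      fix k
      have e: "(- (q ^ a)) * (q ^ 5) ^ k = - (q ^ (k * 5 + a))"
        by (metis mult.commute mult_minus_left power_add power_mult)
      have "(q ^ 5) ^ Suc k = q ^ (k * 5 + (5 - a)) * q ^ a"
      proof -
        have "5 * Suc k = (k * 5 + (5 - a)) + a" using a by auto
        then show ?thesis by (metis power_add power_mult)
      qed
      then have e': "(q ^ 5) ^ Suc k / (- (q ^ a)) = - (q ^ (k * 5 + (5 - a)))"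
        using q by simp
      show "lambert_term q (k * 5 + a) + lambert_term q (k * 5 + (5 - a)) =
        - ((- (q ^ a)) * (q ^ 5) ^ k / (1 + (- (q ^ a)) * (q ^ 5) ^ k)\<^sup>2 + (q ^ 5) ^ Suc k / (- (q ^ a)) / (1 + (q ^ 5) ^ Suc k / (- (q ^ a)))\<^sup>2)"
        unfolding e e' by (simp add: lambert_term_def)
      qed
    qed
    finally show ?thesis by simp
  qed
  have "(\<lambda>n. - (\<Sum>m<n * 5. ?f m)) \<longlonglongrightarrow> - residue_sum {a, 5 - a}"
    unfolding residue_sum_def
    by (intro tendsto_minus filterlim_compose[OF summable_LIMSEQ[OF summable_residue]])
       (rule filterlim_at_top_mono[OF filterlim_ident], auto)
  then show ?thesis unfolding eq[symmetric] .
qed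

lemma chi_lambert_eq: "chi_lambert = residue_sum {1, 4} - residue_sum {2, 3}"
proof -
  have "(if m mod 5 \<in> {1, 4} then lambert_term q m else 0) - (if m mod 5 \<in> {2, 3} then lambert_term q m else 0)
     = of_int (chi_5_3 (int m)) * lambert_term q m" for m
  proof -
    have "int m mod 5 = int (m mod 5)" by (simp add: zmod_int)
    then show ?thesis by (auto simp: chi_5_3_def)
  qed
  then show ?thesis unfolding residue_sum_def chi_lambert_def 
    by (subst suminf_diff[OF summable_residue summable_residue]) simp
qed

text \<open>The difference formula at \<open>w = - q\<close> and \<open>u = - q\<^sup>2\<close> with nome
  \<open>q ^ 5\<close>: the two theta values on its right-hand side are, by symmetry and up to a factor, again those at
  \<open>- q\<^sup>2\<close> and \<open>- q\<close>, so that only their product \<open>euler q * euler (q ^ 5)\<close>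
  is needed.\<close>

theorem ramanujan_lambert: "chi_lambert * euler q = q * euler (q ^ 5) ^ 5"
proof -
  let ?t = "\<lambda>i. theta i (q ^ 5)"
  have nv: "\<forall>k. 1 + (- (q ^ a)) * (q ^ 5) ^ k \<noteq> 0 \<and> 1 + (q ^ 5) ^ Suc k / (- (q ^ a)) \<noteq> 0" if "a \<in> {1, 2}" for a
  proof (intro allI conjI)
    fix k
    have "q ^ a * (q ^ 5) ^ k = q ^ (a + 5 * k)" by (simp add: power_add power_mult)
    moreover have "q ^ (a + 5 * k) < 1" using that q by (subst power_less_one_iff) auto
    ultimately show "1 + (- (q ^ a)) * (q ^ 5) ^ k \<noteq> 0" by simp
    have "(q ^ 5) ^ Suc k / q ^ a = q ^ (5 * Suc k - a)" 
      unfolding power_mult[symmetric] using that q by (subst power_diff) auto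
    moreover have "q ^ (5 * Suc k - a) < 1" using that q by (subst power_less_one_iff) auto
    ultimately show "1 + (q ^ 5) ^ Suc k / (- (q ^ a)) \<noteq> 0" by simp
  qed
  have w: "- (q ^ 1) \<noteq> 0" "- (q ^ 2) \<noteq> 0" using q by auto
  define T1 where "T1 = ?t 0 (- (q ^ 1))"
  define T2 where "T2 = ?t 0 (- (q ^ 2))"
  have T: "T1 * T2 = euler q * euler (q ^ 5)" using theta_product_five by (simp add: T1_def T2_def)
  then have nz: "T1 \<noteq> 0" "T2 \<noteq> 0" using euler_pos[OF q] euler_pos[OF pow5] by auto
  have V1: "?t 0 (- (q ^ 1)) * ?t 2 (- (q ^ 1)) - (?t 1 (- (q ^ 1)))\<^sup>2 = T1\<^sup>2 * - residue_sum {1, 5 - 1}"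
    unfolding T1_def by (rule theta_log_derivative[OF pow5 w(1) nv lambert_sum_lim]) auto
  have V2: "?t 0 (- (q ^ 2)) * ?t 2 (- (q ^ 2)) - (?t 1 (- (q ^ 2)))\<^sup>2 = T2\<^sup>2 * - residue_sum {2, 5 - 2}"
    unfolding T2_def by (rule theta_log_derivative[OF pow5 w(2) nv lambert_sum_lim]) auto
  have arg1: "?t 0 (- (- (q ^ 1) * - (q ^ 2))) = T2"
  proof -
    have "- (- (q ^ 1) * - (q ^ 2)) = q ^ 5 / (- (q ^ 2))" using q by (simp add: eval_nat_numeral)
    then show ?thesis using theta_reflect[OF pow5 w(2)] by (simp add: T2_def)
  qed
  have arg2: "?t 0 (- (- (q ^ 1) / - (q ^ 2))) = - T1 / q"
  proof -
    have "- (- (q ^ 1) / - (q ^ 2)) = 1 / (- (q ^ 1))" using q by (simp add: power2_eq_square)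
    then show ?thesis using theta_shift[OF pow5 w(1)] by (simp add: T1_def)
  qed
  have "T2\<^sup>2 * - residue_sum {2, 5 - 2} * T1\<^sup>2 - T1\<^sup>2 * - residue_sum {1, 5 - 1} * T2\<^sup>2
     = - (q ^ 2) * (euler (q ^ 5) ^ 3)\<^sup>2 * T2 * (- T1 / q)"
    using weierstrass_difference[OF pow5 w, unfolded V1 V2 arg1 arg2 theta_at_minus_one(2)[OF pow5]]
    by (simp add: T1_def T2_def)
  moreover have "(euler (q ^ 5) ^ 3)\<^sup>2 = euler (q ^ 5) ^ 6" by (simp flip: power_mult)
  moreover have "- (q ^ 2) * X * T2 * (- T1 / q) = (T1 * T2) * (q * X)" for X
    using q by (simp add: power2_eq_square)
  ultimately have A: "T2\<^sup>2 * - residue_sum {2, 3} * T1\<^sup>2 - T1\<^sup>2 * - residue_sum {1, 4} * T2\<^sup>2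
     = (T1 * T2) * (q * euler (q ^ 5) ^ 6)" by simp
  have B: "T2\<^sup>2 * - residue_sum {2, 3} * T1\<^sup>2 - T1\<^sup>2 * - residue_sum {1, 4} * T2\<^sup>2
     = (T1 * T2) * ((T1 * T2) * chi_lambert)"
    by (simp add: chi_lambert_eq power2_eq_square right_diff_distrib mult_ac)
  from trans[OF B[symmetric] A]
  have "(T1 * T2) * ((T1 * T2) * chi_lambert) = (T1 * T2) * (q * euler (q ^ 5) ^ 6)" .
  then have "(T1 * T2) * chi_lambert = q * euler (q ^ 5) ^ 6" using nz by simp
  then have "euler (q ^ 5) * (chi_lambert * euler q) = euler (q ^ 5) * (q * euler (q ^ 5) ^ 5)"
    unfolding T by (simp add: eval_nat_numeral mult_ac)
  then show ?thesis using euler_pos[OF pow5] by simp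
qed

end

section \<open>The lattice of charge vectors\<close>

text \<open>Entry \<open>i\<close> of a vector will record the number of beads in residue class \<open>i\<close>,
  relative to the empty partition. Vectors are extensional, so that equality on \<open>{..<t}\<close> is
  equality.\<close>

definition charges :: "nat \<Rightarrow> (nat \<Rightarrow> int) set" where
  "charges t = PiE {..<t} (\<lambda>_. UNIV)"

definition total_charge :: "nat \<Rightarrow> (nat \<Rightarrow> int) \<Rightarrow> int" where
  "total_charge t m = (\<Sum>i<t. m i)"

text \<open>For nonnegative entries this is the sum of all positions \<open>i + t * k\<close> with \<open>i < t\<close>
  and \<open>k < m i\<close>.\<close>

definition energy :: "nat \<Rightarrow> (nat \<Rightarrow> int) \<Rightarrow> int" where
  "energy t m = (\<Sum>i<t. int i * m i + int t * tri (m i))"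

text \<open>The effect on the entries of moving every bead up by one position: residue class \<open>i - 1\<close>
  becomes class \<open>i\<close>, and class \<open>t - 1\<close> becomes class 0 one level higher.\<close>

definition rotate_up :: "nat \<Rightarrow> (nat \<Rightarrow> int) \<Rightarrow> nat \<Rightarrow> int" where
  "rotate_up t m = (\<lambda>i\<in>{..<t}. if i = 0 then m (t - 1) + 1 else m (i - 1))"

definition rotate_down :: "nat \<Rightarrow> (nat \<Rightarrow> int) \<Rightarrow> nat \<Rightarrow> int" where
  "rotate_down t m = (\<lambda>i\<in>{..<t}. if i = t - 1 then m 0 - 1 else m (i + 1))"

lemma total_charge_rotate_up:
  assumes "t > 0"
  shows "total_charge t (rotate_up t m) = total_charge t m + 1"
proof -
  obtain r where r: "t = Suc r" using assms by (cases t) auto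
  show ?thesis unfolding total_charge_def r
    by (subst sum.lessThan_Suc_shift) (simp add: rotate_up_def)
qed

text \<open>Moving every bead up by one adds the number of beads to the sum of the positions.\<close>

lemma energy_rotate_up:
  assumes "t > 0"
  shows "energy t (rotate_up t m) = energy t m + total_charge t m"
proof -
  obtain r where r: "t = Suc r" using assms by (cases t) auto
  have "energy t (rotate_up t m) = int t * tri (m r + 1) + (\<Sum>i<r. int (Suc i) * m i + int t * tri (m i))"
    unfolding energy_def r by (subst sum.lessThan_Suc_shift) (simp add: rotate_up_def)
  also have "\<dots> = energy t m + total_charge t m"
    unfolding tri_add1 by (simp add: energy_def total_charge_def r algebra_simps sum.distrib)
  finally show ?thesis .
qed

lemma rotate_up_down: "m \<in> charges t \<Longrightarrow> t > 0 \<Longrightarrow> rotate_up t (rotate_down t m) = m"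
  by (auto simp: rotate_up_def rotate_down_def charges_def fun_eq_iff PiE_def extensional_def)

lemma rotate_down_up: "m \<in> charges t \<Longrightarrow> t > 0 \<Longrightarrow> rotate_down t (rotate_up t m) = m"
  by (auto simp: rotate_up_def rotate_down_def charges_def fun_eq_iff PiE_def extensional_def)

lemma rotate_in_charges: "rotate_up t m \<in> charges t" "rotate_down t m \<in> charges t"
  by (auto simp: rotate_up_def rotate_down_def charges_def)

definition sector :: "nat \<Rightarrow> int \<Rightarrow> (nat \<Rightarrow> int) set" where
  "sector t s = {m \<in> charges t. total_charge t m = s}"

context
  fixes q :: real and t :: nat
  assumes q: "0 < q" "q < 1" and t: "t > 0"
begin

lemma powt: "0 < q ^ t" "q ^ t < 1"
  using q t by (auto simp: power_less_one_iff)

text \<open>The exponent is a sum of terms that each depend on one entry, so the series factors.\<close>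

lemma infsum_energy: 
  shows "(\<lambda>m. q powi energy t m) summable_on charges t"
    and "(\<Sum>\<^sub>\<infinity>m\<in>charges t. q powi energy t m) = (\<Prod>i<t. theta 0 (q ^ t) (q ^ i))"
proof -
  have eq: "q powi energy t m = (\<Prod>i<t. (q ^ i) powi m i * (q ^ t) powi tri (m i))" for m
  proof -
    have "q powi (\<Sum>i\<in>A. f i) = (\<Prod>i\<in>A. q powi f i)" if "finite A" for A and f :: "nat \<Rightarrow> int"
      using that by (induction) (use q in \<open>auto simp: power_int_add\<close>)
    then show ?thesis using q
      by (simp add: energy_def power_int_add power_int_mult)
  qed
  have "(\<lambda>j. norm ((q ^ i) powi j * (q ^ t) powi tri j)) summable_on UNIV" for i
    using theta_summable[OF powt, of "q ^ i" 0] q by simp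
  then show *: "(\<Sum>\<^sub>\<infinity>m\<in>charges t. q powi energy t m) = (\<Prod>i<t. theta 0 (q ^ t) (q ^ i))"
    unfolding eq charges_def by (subst infsum_prod_PiE_abs) (auto simp: theta_def)
  have "(\<Prod>i<t. theta 0 (q ^ t) (q ^ i)) > 0"
    by (intro prod_pos) (use theta_pos[OF powt] q in auto)
  \<comment> \<open>The sum is a positive product, while a family that is not summable has sum 0 by convention.\<close>
  then show "(\<lambda>m. q powi energy t m) summable_on charges t"
    using * infsum_not_exists[of "\<lambda>m. q powi energy t m" "charges t"] by (metis less_irrefl)
qed

definition sector_sum :: "int \<Rightarrow> real" where
  "sector_sum s = (\<Sum>\<^sub>\<infinity>m\<in>sector t s. q powi energy t m)"

lemma sector_has_sum: "((\<lambda>m. q powi energy t m) has_sum sector_sum s) (sector t s)"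
  unfolding sector_sum_def
  by (rule has_sum_infsum, rule summable_on_subset[OF infsum_energy(1)]) (auto simp: sector_def)

lemma sector_sum_add1: "sector_sum (s + 1) = q powi s * sector_sum s"
proof -
  have "sector_sum (s + 1) = (\<Sum>\<^sub>\<infinity>m\<in>sector t s. q powi s * q powi energy t m)"
    unfolding sector_sum_def
  proof (rule infsum_reindex_bij_witness[where i = "rotate_up t" and j = "rotate_down t"])
    fix m assume m: "m \<in> sector t (s + 1)"
    then have *: "rotate_up t (rotate_down t m) = m" using rotate_up_down t by (auto simp: sector_def)
    then show "rotate_up t (rotate_down t m) = m" .
    show "rotate_down t m \<in> sector t s"
      using total_charge_rotate_up[OF t, of "rotate_down t m"] m * rotate_in_charges by (auto simp: sector_def)
    then show "q powi s * q powi energy t (rotate_down t m) = q powi energy t m"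
      using energy_rotate_up[OF t, of "rotate_down t m"] * q by (auto simp: sector_def power_int_add)
  qed (use rotate_down_up total_charge_rotate_up rotate_in_charges t in \<open>auto simp: sector_def\<close>)
  then show ?thesis unfolding sector_sum_def by (simp only: infsum_cmult_right')
qed

text \<open>So the sums over the sectors are, up to a common factor, the terms of \<open>theta 0 q 1\<close>.\<close>

lemma sector_sum_eq: "sector_sum s = q powi tri s * sector_sum 0"
proof (induction s rule: int_induct[where k = 0])
  case (step1 s)
  have "sector_sum (s + 1) = q powi s * sector_sum s" by (rule sector_sum_add1)
  with step1 q show ?case by (simp add: tri_add1 power_int_add)
next
  case (step2 s)
  have "sector_sum s = q powi (s - 1) * sector_sum (s - 1)" using sector_sum_add1[of "s - 1"] by simp
  moreover have "tri s = tri (s - 1) + (s - 1)" using tri_add1[of "s - 1"] by simp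
  ultimately show ?case using step2 q by (simp add: power_int_add)
qed (simp add: tri_def)

lemma sector_sum_theta: "sector_sum 0 * theta 0 q 1 = (\<Prod>i<t. theta 0 (q ^ t) (q ^ i))"
proof -
  have "((\<lambda>m. q powi energy t m) has_sum (\<Prod>i<t. theta 0 (q ^ t) (q ^ i))) (charges t)"
    using infsum_energy has_sum_infsum by metis
  then have "((\<lambda>(s, m). q powi energy t m) has_sum (\<Prod>i<t. theta 0 (q ^ t) (q ^ i))) (Sigma UNIV (sector t))"
    by (rule has_sum_reindex_bij_witness[where j = "\<lambda>m. (total_charge t m, m)" and i = snd, THEN iffD1, rotated 6])
       (auto simp: sector_def)
  then have "((\<lambda>s. sector_sum s) has_sum (\<Prod>i<t. theta 0 (q ^ t) (q ^ i))) UNIV"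
    by (rule has_sum_SigmaD) (simp add: sector_has_sum)
  moreover have "((\<lambda>s. q powi tri s * sector_sum 0) has_sum theta 0 q 1 * sector_sum 0) UNIV"
    using has_sum_cmult_left[OF theta_has_sum[OF q, of 1 0]] by simp
  then have "((\<lambda>s. sector_sum s) has_sum theta 0 q 1 * sector_sum 0) UNIV"
    by (subst sector_sum_eq)
  ultimately show ?thesis using has_sum_unique by (fastforce simp: mult.commute)
qed

text \<open>Both kinds of factors run through all exponents once; in the second kind the residues modulo
  \<open>t\<close> occur in reverse order.\<close>

lemma jtp_prod_split: "(\<Prod>i<t. jtp_prod (q ^ t) (q ^ i) n) = jtp_prod q 1 (n * t)"
proof -
  have 1: "(\<Prod>j<n * t. g j) = (\<Prod>k<n. \<Prod>i<t. g (k * t + i))" for g :: "nat \<Rightarrow> real"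
  proof -
    have "(\<Prod>j\<in>{k * t..<k * t + t}. g j) = (\<Prod>i<t. g (k * t + i))" for k
      by (rule prod.reindex_bij_witness[where i = "\<lambda>i. k * t + i" and j = "\<lambda>i. i - k * t"]) auto
    then show ?thesis by (simp flip: prod.nat_group)
  qed
  have "(\<Prod>i<t. jtp_prod (q ^ t) (q ^ i) n)
     = (\<Prod>k<n. \<Prod>i<t. (1 + q ^ i * (q ^ t) ^ k) * (1 + (q ^ t) ^ Suc k / q ^ i))"
    unfolding jtp_prod_def by (rule prod.swap)
  also have "\<dots> = (\<Prod>k<n. (\<Prod>i<t. 1 + q ^ (k * t + i)) * (\<Prod>i<t. 1 + q ^ Suc (k * t + (t - Suc i))))"
  proof (rule prod.cong[OF refl])
    fix k
    have "q ^ i * (q ^ t) ^ k = q ^ (k * t + i)" for i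
      by (metis mult.commute power_add power_mult)
    moreover have "(q ^ t) ^ Suc k / q ^ i = q ^ Suc (k * t + (t - Suc i))" if "i < t" for i
    proof -
      have "t * Suc k = Suc (k * t + (t - Suc i)) + i" using that by simp
      then have "(q ^ t) ^ Suc k = q ^ Suc (k * t + (t - Suc i)) * q ^ i" by (metis power_add power_mult)
      then show ?thesis using q by simp
    qed
    ultimately show "(\<Prod>i<t. (1 + q ^ i * (q ^ t) ^ k) * (1 + (q ^ t) ^ Suc k / q ^ i))
      = (\<Prod>i<t. 1 + q ^ (k * t + i)) * (\<Prod>i<t. 1 + q ^ Suc (k * t + (t - Suc i)))"
      unfolding prod.distrib by (intro arg_cong2[of _ _ _ _ times] prod.cong) auto
  qed
  also have "\<dots> = (\<Prod>k<n. \<Prod>i<t. (1 + q ^ (k * t + i)) * (1 + q ^ Suc (k * t + i)))"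
    by (simp only: prod.distrib prod.nat_diff_reindex[of "\<lambda>i. 1 + q ^ Suc (k * t + i)" t for k])
  also have "\<dots> = jtp_prod q 1 (n * t)"
    by (simp add: jtp_prod_def 1)
  finally show ?thesis .
qed

text \<open>Divide the triple products for \<open>w = q ^ i\<close> with nome \<open>q ^ t\<close> by the one for
  \<open>w = 1\<close> with nome \<open>q\<close>: the infinite products in \<open>1 + q ^ k\<close> cancel and only the
  Euler factors remain.\<close>

theorem zero_sector_product: "sector_sum 0 * euler q = euler (q ^ t) ^ t"
proof -
  have "(\<lambda>n. \<Prod>i<t. jtp_prod (q ^ t) (q ^ i) n) \<longlonglongrightarrow> (\<Prod>i<t. theta 0 (q ^ t) (q ^ i) / euler (q ^ t))"
    by (intro tendsto_prod jacobi_triple_product[OF powt]) (use q in auto)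
  moreover have "(\<lambda>n. jtp_prod q 1 (n * t)) \<longlonglongrightarrow> theta 0 q 1 / euler q"
  proof (rule filterlim_compose[OF jacobi_triple_product[OF q one_neq_zero]])
    show "filterlim (\<lambda>n. n * t) at_top sequentially"
      by (rule filterlim_at_top_mono[OF filterlim_ident]) (use t in auto)
  qed
  ultimately have "(\<Prod>i<t. theta 0 (q ^ t) (q ^ i) / euler (q ^ t)) = theta 0 q 1 / euler q"
    unfolding jtp_prod_split by (rule LIMSEQ_unique)
  then have "sector_sum 0 * theta 0 q 1 / euler (q ^ t) ^ t = theta 0 q 1 / euler q"
    by (simp add: sector_sum_theta prod_dividef)
  moreover have "theta 0 q 1 > 0" by (intro theta_pos[OF q]) auto
  ultimately show ?thesis using euler_pos[OF q] euler_pos[OF powt]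
    by (simp add: divide_simps mult_ac)
qed

end

section \<open>Beads of a partition\<close>

lemma downclosed_eq_lessThan:
  fixes S :: "nat set"
  assumes "finite S" and down: "\<And>i j. i \<le> j \<Longrightarrow> j \<in> S \<Longrightarrow> i \<in> S"
  shows "S = {..<card S}"
proof -
  obtain n where n: "n \<notin> S" using assms(1) ex_new_if_finite infinite_UNIV_nat by blast
  define m where "m = (LEAST n. n \<notin> S)"
  have "m \<notin> S" unfolding m_def using n by (rule LeastI)
  moreover have "i \<in> S" if "i < m" for i using not_less_Least[of i "\<lambda>n. n \<notin> S"] that m_def by blast
  ultimately have "S = {..<m}" using down by (meson lessThan_iff not_le subsetI subset_antisym)
  then show ?thesis by simp
qed

definition row_len :: "nat list \<Rightarrow> nat \<Rightarrow> nat" where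
  "row_len p i = (if i < length p then p ! i else 0)"

definition col_len :: "nat list \<Rightarrow> nat \<Rightarrow> nat" where
  "col_len p j = card {i. j < row_len p i}"

text \<open>For \<open>l\<close> at least the number of parts, these are the hook lengths in the first column, if empty
  rows are added until there are \<open>l\<close> rows.\<close>

definition bead :: "nat \<Rightarrow> nat list \<Rightarrow> nat \<Rightarrow> nat" where
  "bead l p i = row_len p i + (l - Suc i)"

definition beads :: "nat \<Rightarrow> nat list \<Rightarrow> nat set" where
  "beads l p = bead l p ` {..<l}"

text \<open>The positions without a bead, in increasing order; there is one for each column, empty columns
  included.\<close>

definition gap :: "nat \<Rightarrow> nat list \<Rightarrow> nat \<Rightarrow> nat" where
  "gap l p j = j + l - col_len p j"

lemma young_diagram_row: "young_diagram p = {(i, j). j < row_len p i}"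
  by (auto simp: young_diagram_def row_len_def split: if_splits)

lemma row_antimono:
  assumes "is_partition p" "i \<le> j"
  shows "row_len p j \<le> row_len p i"
proof (cases "i = j")
  case False
  then show ?thesis using assms sorted_wrt_nth_less[of "(\<ge>)" p i j]
    by (auto simp: row_len_def is_partition_def)
qed simp

lemma finite_row: "finite {i. j < row_len p i}"
  by (rule finite_subset[of _ "{..<length p}"]) (auto simp: row_len_def split: if_splits)

lemma less_column_iff:
  assumes "is_partition p"
  shows "i < col_len p j \<longleftrightarrow> j < row_len p i"
proof -
  have "{i. j < row_len p i} = {..<col_len p j}"
    unfolding col_len_def using finite_row
    by (rule downclosed_eq_lessThan) (use row_antimono[OF assms] less_le_trans in blast)
  then show ?thesis by blast
qed

lemma column_le: "col_len p j \<le> length p"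
proof -
  have "col_len p j \<le> card {..<length p}"
    unfolding col_len_def by (rule card_mono) (auto simp: row_len_def split: if_splits)
  then show ?thesis by simp
qed

lemma partition_eqI:
  assumes p: "is_partition p" and p': "is_partition p'" and eq: "\<And>i. row_len p i = row_len p' i"
  shows "p = p'"
proof -
  have len: "length p = col_len p 0" if "is_partition p" for p
  proof -
    have "{i. 0 < row_len p i} = {..<length p}" using that by (auto simp: row_len_def is_partition_def split: if_splits)
    then show ?thesis by (simp add: col_len_def)
  qed
  show ?thesis
  proof (rule nth_equalityI)
    show l: "length p = length p'" using len[OF p] len[OF p'] eq by (simp add: col_len_def)
    fix i assume "i < length p"
    then show "p ! i = p' ! i" using eq[of i] l by (simp add: row_len_def)
  qed
qed

lemma partition_of_rows:
  assumes anti: "\<And>i. f (Suc i) \<le> f i" and zero: "f l = (0::nat)"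
  shows "\<exists>p. is_partition p \<and> length p \<le> l \<and> (\<forall>i. row_len p i = f i)"
proof -
  have anti': "f j \<le> f i" if "i \<le> j" for i j
    using lift_Suc_antimono_le[of f, OF anti that] .
  define n where "n = (LEAST i. f i = 0)"
  have n0: "f n = 0" unfolding n_def by (rule LeastI[where P = "\<lambda>i. f i = 0", OF zero])
  have nl: "n \<le> l" unfolding n_def by (rule Least_le[where P = "\<lambda>i. f i = 0", OF zero])
  have pos: "0 < f i" if "i < n" for i using not_less_Least[of i "\<lambda>i. f i = 0"] that n_def by auto
  let ?p = "map f [0..<n]"
  have "is_partition ?p"
    using pos anti' by (auto simp: is_partition_def sorted_wrt_iff_nth_less)
  moreover have "row_len ?p i = f i" for i
    using anti'[of n i] n0 by (auto simp: row_len_def)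
  ultimately show ?thesis using nl by (intro exI[of _ ?p]) auto
qed

lemma bead_less:
  assumes "is_partition p" "i < j" "j < l"
  shows "bead l p j < bead l p i"
  using row_antimono[OF assms(1), of i j] assms(2,3) by (auto simp: bead_def)

lemma inj_bead: "is_partition p \<Longrightarrow> inj_on (bead l p) {..<l}"
  by (rule linorder_inj_onI') (use bead_less in \<open>fastforce\<close>)

lemma card_beads: "is_partition p \<Longrightarrow> card (beads l p) = l"
  unfolding beads_def by (subst card_image[OF inj_bead]) auto

text \<open>The arm of the cell is \<open>row_len p i - j - 1\<close> and its leg is
  \<open>col_len p j - i - 1\<close>.\<close>

lemma hook_plus_gap:
  assumes p: "is_partition p" and l: "length p \<le> l" and j: "j < row_len p i"
  shows "hook_number p (i, j) + gap l p j = bead l p i"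
proof -
  have i: "i < col_len p j" using j less_column_iff[OF p] by blast
  have cl: "col_len p j \<le> l" using column_le l le_trans by blast
  have "{d \<in> young_diagram p. (fst d = i \<and> j \<le> snd d) \<or> (snd d = j \<and> i \<le> fst d)}
     = (\<lambda>k. (i, k)) ` {j..<row_len p i} \<union> (\<lambda>k. (k, j)) ` {Suc i..<col_len p j}"
    using j i by (auto simp: young_diagram_row less_column_iff[OF p] Suc_le_eq le_less image_iff)
  moreover have "card \<dots> = (row_len p i - j) + (col_len p j - Suc i)"
    by (subst card_Un_disjoint) (auto simp: card_image inj_on_def)
  ultimately have "hook_number p (i, j) = (row_len p i - j) + (col_len p j - Suc i)"
    by (simp add: hook_number_def)
  then show ?thesis using i j cl by (simp add: bead_def gap_def)
qed

lemma gap_notin_beads: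
  assumes p: "is_partition p" and l: "length p \<le> l"
  shows "gap l p j \<notin> beads l p"
proof
  assume "gap l p j \<in> beads l p"
  then obtain k where k: "k < l" "gap l p j = bead l p k" by (auto simp: beads_def)
  have cl: "col_len p j \<le> l" using column_le l le_trans by blast
  show False
  proof (cases "k < col_len p j")
    case True
    then have "j < row_len p k" using less_column_iff[OF p] by blast
    with True k cl show False by (simp add: bead_def gap_def)
  next
    case False
    then have "\<not> j < row_len p k" using less_column_iff[OF p] by blast
    with False k cl show False by (simp add: bead_def gap_def)
  qed
qed

lemma inj_gap:
  assumes p: "is_partition p" and l: "length p \<le> l"
  shows "inj (gap l p)"
proof (rule linorder_inj_onI')
  fix j k :: nat assume jk: "j < k"
  have cl: "col_len p j \<le> l" using column_le l le_trans by blast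
  have "col_len p k \<le> col_len p j"
    unfolding col_len_def by (rule card_mono[OF finite_row]) (use jk in auto)
  with jk cl show "gap l p j \<noteq> gap l p k" by (simp add: gap_def)
qed

text \<open>The gaps of the columns that meet row \<open>i\<close> lie below its bead and carry no bead. They are all
  such positions because the numbers agree: of the positions below the bead, exactly \<open>l - Suc i\<close> carry a
  bead.\<close>

lemma gaps_below_bead:
  assumes p: "is_partition p" and l: "length p \<le> l" and i: "i < l"
  shows "gap l p ` {..<row_len p i} = {y. y < bead l p i \<and> y \<notin> beads l p}"
proof (rule card_subset_eq)
  show "finite {y. y < bead l p i \<and> y \<notin> beads l p}" by simp
  have pos: "gap l p j < bead l p i" if j: "j < row_len p i" for j
  proof -
    have "i < col_len p j" using j less_column_iff[OF p] by blast
    moreover have "col_len p j \<le> l" using column_le l le_trans by blast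
    ultimately show ?thesis using j by (simp add: bead_def gap_def)
  qed
  then show "gap l p ` {..<row_len p i} \<subseteq> {y. y < bead l p i \<and> y \<notin> beads l p}"
    using gap_notin_beads[OF p l] by auto
  have "{y. y < bead l p i \<and> y \<notin> beads l p} = {..<bead l p i} - bead l p ` {Suc i..<l}"
  proof -
    have "bead l p k < bead l p i \<longleftrightarrow> i < k" if "k < l" for k
      using bead_less[OF p, of i k l] bead_less[OF p, of k i l] that i
      by (cases k i rule: linorder_cases) auto
    then show ?thesis by (auto simp: beads_def image_iff Suc_le_eq)
  qed
  moreover have "bead l p ` {Suc i..<l} \<subseteq> {..<bead l p i}"
    using bead_less[OF p] by auto
  moreover have "card (bead l p ` {Suc i..<l}) = l - Suc i"
    by (subst card_image) (auto intro: inj_on_subset[OF inj_bead[OF p]])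
  ultimately have "card {y. y < bead l p i \<and> y \<notin> beads l p} = row_len p i"
    by (simp add: card_Diff_subset bead_def)
  then show "card (gap l p ` {..<row_len p i}) = card {y. y < bead l p i \<and> y \<notin> beads l p}"
    using inj_gap[OF p l] by (simp add: card_image inj_on_subset)
qed

lemma hooks_of_row:
  assumes p: "is_partition p" and l: "length p \<le> l" and i: "i < l"
  shows "(\<lambda>j. hook_number p (i, j)) ` {..<row_len p i} = {bead l p i - y |y. y < bead l p i \<and> y \<notin> beads l p}"
proof -
  have "hook_number p (i, j) = bead l p i - gap l p j" if "j < row_len p i" for j
    using hook_plus_gap[OF p l that] by simp
  then have "(\<lambda>j. hook_number p (i, j)) ` {..<row_len p i} = (\<lambda>y. bead l p i - y) ` gap l p ` {..<row_len p i}"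
    by (force simp: image_image)
  then show ?thesis unfolding gaps_below_bead[OF p l i] by auto
qed

text \<open>On an abacus with \<open>t\<close> runners, every bead rests on another one or on the bottom.\<close>

definition pushed_down :: "nat \<Rightarrow> nat set \<Rightarrow> bool" where
  "pushed_down t X \<longleftrightarrow> (\<forall>x\<in>X. t \<le> x \<longrightarrow> x - t \<in> X)"

lemma pushed_downD:
  assumes "pushed_down t X" "y + t * k \<in> X"
  shows "y \<in> X"
  using assms(2)
proof (induction k)
  case (Suc k)
  then have "y + t * Suc k - t \<in> X" using assms(1) by (auto simp: pushed_down_def)
  then show ?case using Suc.IH by simp
qed simp

text \<open>If a bead can fall by a multiple of \<open>t\<close> onto a free position, then on the way there some bead
  can fall by exactly \<open>t\<close>.\<close>

lemma is_core_iff_pushed_down: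
  assumes p: "is_partition p" and l: "length p \<le> l" and t: "t > 0"
  shows "is_core t p \<longleftrightarrow> pushed_down t (beads l p)"
proof -
  have row0: "row_len p i = 0" if "\<not> i < l" for i using that l by (simp add: row_len_def)
  have "is_core t p \<longleftrightarrow> (\<forall>i<l. \<forall>h \<in> (\<lambda>j. hook_number p (i, j)) ` {..<row_len p i}. \<not> t dvd h)"
  proof
    assume "is_core t p"
    then show "\<forall>i<l. \<forall>h \<in> (\<lambda>j. hook_number p (i, j)) ` {..<row_len p i}. \<not> t dvd h"
      by (auto simp: is_core_def young_diagram_row)
  next
    assume *: "\<forall>i<l. \<forall>h \<in> (\<lambda>j. hook_number p (i, j)) ` {..<row_len p i}. \<not> t dvd h"
    have "\<not> t dvd hook_number p (i, j)" if "j < row_len p i" for i j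
    proof -
      have "i < l" using row0[of i] that by (metis not_less_zero)
      with * that show ?thesis by blast
    qed
    then show "is_core t p" by (auto simp: is_core_def young_diagram_row)
  qed
  also have "\<dots> \<longleftrightarrow> (\<forall>x\<in>beads l p. \<forall>y. y < x \<and> y \<notin> beads l p \<longrightarrow> \<not> t dvd x - y)"
  proof -
    have row: "(\<forall>h \<in> (\<lambda>j. hook_number p (i, j)) ` {..<row_len p i}. \<not> t dvd h)
       \<longleftrightarrow> (\<forall>y. y < bead l p i \<and> y \<notin> beads l p \<longrightarrow> \<not> t dvd bead l p i - y)" if "i < l" for i
      unfolding hooks_of_row[OF p l that] by blast
    have ball: "(\<forall>x\<in>beads l p. Q x) \<longleftrightarrow> (\<forall>i<l. Q (bead l p i))" for Q
      by (auto simp: beads_def)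
    show ?thesis unfolding ball by (rule all_cong) (rule row)
  qed
  also have "\<dots> \<longleftrightarrow> pushed_down t (beads l p)"
  proof
    assume *: "\<forall>x\<in>beads l p. \<forall>y. y < x \<and> y \<notin> beads l p \<longrightarrow> \<not> t dvd x - y"
    show "pushed_down t (beads l p)" unfolding pushed_down_def
    proof (intro ballI impI)
      fix x assume "x \<in> beads l p" "t \<le> x"
      then show "x - t \<in> beads l p" using *[rule_format, of x "x - t"] t by auto
    qed
  next
    assume pd: "pushed_down t (beads l p)"
    show "\<forall>x\<in>beads l p. \<forall>y. y < x \<and> y \<notin> beads l p \<longrightarrow> \<not> t dvd x - y"
    proof (intro ballI allI impI notI)
      fix x y assume x: "x \<in> beads l p" "y < x \<and> y \<notin> beads l p" "t dvd x - y"
      then obtain k where "x - y = t * k" by (auto elim: dvdE)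
      then have "x = y + t * k" using x by linarith
      with pushed_downD[OF pd, of y k] x show False by simp
    qed
  qed
  finally show ?thesis .
qed

lemma sum_beads:
  assumes p: "is_partition p" and l: "length p \<le> l"
  shows "\<Sum>(beads l p) = sum_list p + \<Sum>{..<l}"
proof -
  have "\<Sum>(beads l p) = (\<Sum>i<l. row_len p i) + (\<Sum>i<l. l - Suc i)"
    unfolding beads_def by (subst sum.reindex[OF inj_bead[OF p]]) (simp only: bead_def sum.distrib o_def)
  moreover have "(\<Sum>i<l. l - Suc i) = \<Sum>{..<l}"
    by (rule sum.nat_diff_reindex)
  moreover have "(\<Sum>i<l. row_len p i) = (\<Sum>i<length p. row_len p i)"
    by (rule sum.mono_neutral_right) (use l in \<open>auto simp: row_len_def\<close>)
  moreover have "\<dots> = sum_list p"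
    by (simp add: sum_list_sum_nth row_len_def atLeast0LessThan)
  ultimately show ?thesis by simp
qed

lemma sorted_beads:
  assumes p: "is_partition p"
  shows "sorted_list_of_set (beads l p) = rev (map (bead l p) [0..<l])"
proof (rule strict_sorted_equal)
  show "sorted_wrt (<) (rev (map (bead l p) [0..<l]))"
    unfolding sorted_wrt_rev using bead_less[OF p] by (auto simp: sorted_wrt_iff_nth_less)
qed (auto simp: beads_def)

lemma beads_inj:
  assumes p: "is_partition p" "length p \<le> l" and p': "is_partition p'" "length p' \<le> l"
    and eq: "beads l p = beads l p'"
  shows "p = p'"
proof (rule partition_eqI[OF p(1) p'(1)])
  have "map (bead l p) [0..<l] = map (bead l p') [0..<l]"
    using sorted_beads[OF p(1), of l] sorted_beads[OF p'(1), of l] eq by simp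
  then have "bead l p i = bead l p' i" if "i < l" for i using that by auto
  then have "row_len p i + (l - Suc i) = row_len p' i + (l - Suc i)" if "i < l" for i
    using that unfolding bead_def by blast
  then show "row_len p i = row_len p' i" for i
    using p(2) p'(2) by (cases "i < l") (blast intro: add_right_imp_eq, simp add: row_len_def)
qed

text \<open>List the positions in decreasing order and subtract \<open>l - 1, ..., 1, 0\<close>; strict decrease becomes
  weak decrease.\<close>

lemma beads_surj:
  assumes X: "finite X" "card X = l"
  shows "\<exists>p. is_partition p \<and> length p \<le> l \<and> beads l p = X"
proof -
  define xs where "xs = rev (sorted_list_of_set X)"
  have len: "length xs = l" and set: "set xs = X" using X by (auto simp: xs_def)
  have "sorted_wrt (>) xs" unfolding xs_def sorted_wrt_rev by simp
  then have dec: "xs ! Suc i < xs ! i" if "Suc i < l" for i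
    using that len sorted_wrt_nth_less[of "(>)" xs i "Suc i"] by auto
  have ge: "l - Suc i \<le> xs ! i" if "i < l" for i
  proof -
    have "i \<le> l - 1" using that by simp
    then show ?thesis
    proof (induction rule: inc_induct)
      case (step n)
      then have "Suc n < l" by simp
      with step show ?case using dec[of n] by auto
    qed (use that in auto)
  qed
  define f where "f i = (if i < l then xs ! i - (l - Suc i) else 0)" for i
  have "f (Suc i) \<le> f i" for i using dec[of i] by (auto simp: f_def)
  moreover have "f l = 0" by (simp add: f_def)
  ultimately obtain p where p: "is_partition p" "length p \<le> l" "\<forall>i. row_len p i = f i"
    using partition_of_rows[of f l] by blast
  have "bead l p i = xs ! i" if "i < l" for i using ge[OF that] that p(3) by (simp add: bead_def f_def)
  then have "beads l p = (\<lambda>i. xs ! i) ` {..<l}" by (auto simp: beads_def)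
  also have "\<dots> = X" using len set by (auto simp: set_conv_nth)
  finally show ?thesis using p by blast
qed

section \<open>Cores as charge vectors\<close>

text \<open>The abacus position with \<open>c i\<close> beads at the bottom of runner \<open>i\<close>.\<close>

definition fill :: "nat \<Rightarrow> (nat \<Rightarrow> nat) \<Rightarrow> nat set" where
  "fill t c = {x. x div t < c (x mod t)}"

lemma sum_fill:
  assumes t: "t > 0"
  shows "finite (fill t c)" "(\<Sum>x\<in>fill t c. f x) = (\<Sum>i<t. \<Sum>k<c i. f (k * t + i))"
proof -
  have im: "fill t c = (\<lambda>(i, k). k * t + i) ` Sigma {..<t} (\<lambda>i. {..<c i})"
  proof (intro equalityI subsetI)
    fix x assume "x \<in> fill t c"
    then show "x \<in> (\<lambda>(i, k). k * t + i) ` Sigma {..<t} (\<lambda>i. {..<c i})"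
      using t by (intro image_eqI[of _ _ "(x mod t, x div t)"]) (auto simp: fill_def)
  qed (use t in \<open>auto simp: fill_def\<close>)
  show "finite (fill t c)" unfolding im by auto
  have "inj_on (\<lambda>(i, k). k * t + i) (Sigma {..<t} (\<lambda>i. {..<c i}))"
  proof (rule inj_onI, clarify)
    fix i k i' k' assume "i < t" "i' < t" and e: "k * t + i = k' * t + (i'::nat)"
    then have "i = i'" "k = k'"
      by (metis mod_less mod_mult_self3, metis div_less div_mult_self3 add_0_right not_less_zero)
    then show "i = i' \<and> k = k'" by simp
  qed
  then show "(\<Sum>x\<in>fill t c. f x) = (\<Sum>i<t. \<Sum>k<c i. f (k * t + i))"
    unfolding im by (subst sum.reindex) (auto simp: sum.Sigma case_prod_unfold)
qed

lemma card_fill: "t > 0 \<Longrightarrow> int (card (fill t c)) = total_charge t (\<lambda>i. int (c i))"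
  using sum_fill(2)[of t "\<lambda>_. 1::nat" c] sum_fill(1)[of t c] by (simp add: total_charge_def)

lemma sum_lessThan_tri: "(\<Sum>k<n. int k) = tri (int n)"
  by (induction n) (simp_all add: tri_def[of 0] tri_add1 add.commute[of 1])

lemma sum_fill_energy: "t > 0 \<Longrightarrow> int (\<Sum>(fill t c)) = energy t (\<lambda>i. int (c i))"
proof -
  assume t: "t > 0"
  have "int (\<Sum>(fill t c)) = (\<Sum>i<t. \<Sum>k<c i. int k * int t + int i)"
    using sum_fill(2)[OF t, of "\<lambda>x. x" c] by simp
  also have "\<dots> = (\<Sum>i<t. tri (int (c i)) * int t + int (c i) * int i)"
    by (simp add: sum.distrib sum_distrib_right[symmetric] sum_lessThan_tri)
  finally show ?thesis by (simp add: energy_def algebra_simps)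
qed

lemma pushed_down_fill: "t > 0 \<Longrightarrow> pushed_down t (fill t c)"
  by (auto simp: pushed_down_def fill_def le_div_geq le_mod_geq)

lemma pushed_down_imp_fill:
  assumes t: "t > 0" and X: "finite X" "pushed_down t X"
  shows "\<exists>c. X = fill t c"
proof -
  define c where "c i = card {k. k * t + i \<in> X}" for i
  have c: "{k. k * t + i \<in> X} = {..<c i}" for i
    unfolding c_def
  proof (rule downclosed_eq_lessThan)
    have "inj (\<lambda>k. k * t + i)" using t by (auto simp: inj_on_def)
    from finite_vimageI[OF X(1) this] show "finite {k. k * t + i \<in> X}" by (simp add: vimage_def)
    fix k k' assume "k \<le> k'" "k' \<in> {k. k * t + i \<in> X}"
    then have "(k * t + i) + t * (k' - k) \<in> X" by (simp add: algebra_simps diff_mult_distrib2)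
    then show "k \<in> {k. k * t + i \<in> X}" using pushed_downD[OF X(2)] by blast
  qed
  have "x \<in> X \<longleftrightarrow> x \<in> fill t c" for x
  proof -
    have "x div t \<in> {k. k * t + x mod t \<in> X} \<longleftrightarrow> x div t \<in> {..<c (x mod t)}"
      unfolding c ..
    then show ?thesis unfolding fill_def by simp
  qed
  then show ?thesis by blast
qed

lemma fill_eqD:
  assumes t: "t > 0" and "fill t c = fill t c'" and i: "i < t"
  shows "c i = c' i"
proof -
  have "k < c i \<longleftrightarrow> k < c' i" for k
  proof -
    have "(k * t + i) div t = k" "(k * t + i) mod t = i" using i t by auto
    then show ?thesis using assms(2) by (auto simp: fill_def set_eq_iff dest: spec[of _ "k * t + i"])
  qed
  then show ?thesis by (meson nat_neq_iff)
qed

lemma tri_add: "tri (a + b) = tri a + tri b + a * b"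
  by (rule tri_eqI) (use two_tri[of a] two_tri[of b] in \<open>simp add: algebra_simps\<close>)

text \<open>On vectors with sum zero, adding a constant \<open>L\<close> to every entry changes the energy by a
  constant. This compares the bead counts, which are nonnegative, with the charges, which are not.\<close>

lemma energy_shift:
  "energy t (\<lambda>i. m i + L) = energy t m + int t * L * total_charge t m + energy t (\<lambda>_. L)"
  by (simp add: energy_def total_charge_def tri_add algebra_simps sum.distrib sum_distrib_left)

lemma energy_const: "t > 0 \<Longrightarrow> energy t (\<lambda>_. int L) = int (\<Sum>{..<t * L})"
proof -
  assume t: "t > 0"
  have "fill t (\<lambda>_. L) = {..<t * L}"
    using t by (auto simp: fill_def div_less_iff_less_mult mult.commute)
  then show ?thesis using sum_fill_energy[OF t, of "\<lambda>_. L"] by simp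
qed

lemma energy_term_bound:
  assumes i: "i < t"
  shows "int i * x + int t * tri x \<ge> max 0 (- x)"
proof (cases "x \<ge> 0")
  case True
  then show ?thesis using tri_nonneg[of x] by simp
next
  case False
  have "tri x \<ge> - x"
  proof -
    have "x * (x - 1) \<ge> 2 * (- x)"
      using mult_nonneg_nonneg[of "-x" "-(x+1)"] False by (simp add: algebra_simps)
    then show ?thesis using two_tri[of x] by linarith
  qed
  then have "int t * tri x \<ge> int t * (- x)" by (intro mult_left_mono) auto
  moreover have "(int t - int i) * (- x) \<ge> 1 * (- x)" using False i by (intro mult_right_mono) auto
  ultimately show ?thesis using False by (simp add: algebra_simps)
qed

lemma energy_nonneg: "energy t m \<ge> 0"
  unfolding energy_def using energy_term_bound max.bounded_iff by (intro sum_nonneg) fastforce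

text \<open>No term of the energy is negative, so no runner can miss more than \<open>n\<close> beads: \<open>n\<close>
  levels per runner, that is, \<open>t * n\<close> beads in total, suffice for all cores of size
  \<open>n\<close>.\<close>

lemma charge_lower_bound:
  assumes "energy t m = int n" "i < t"
  shows "- int n \<le> m i"
proof -
  have "int i * m i + int t * tri (m i) \<le> energy t m"
    unfolding energy_def
  proof (rule member_le_sum)
    show "0 \<le> int x * m x + int t * tri (m x)" if "x \<in> {..<t} - {i}" for x
      using energy_term_bound[of x t "m x"] that by auto
  qed (use assms in auto)
  with energy_term_bound[OF assms(2), of "m i"] assms(1) show ?thesis by linarith
qed

text \<open>The bead sets of the cores of size \<open>n\<close>, with \<open>t * n\<close> beads; the empty partition
  has the beads \<open>{..<t * n}\<close>.\<close>

definition core_beads :: "nat \<Rightarrow> nat \<Rightarrow> nat set set" where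
  "core_beads t n = {X. finite X \<and> card X = t * n \<and> pushed_down t X \<and> \<Sum>X = n + \<Sum>{..<t * n}}"

definition cores :: "nat \<Rightarrow> nat \<Rightarrow> nat list set" where
  "cores t n = {p. is_partition p \<and> sum_list p = n \<and> is_core t p}"

lemma bij_cores_beads:
  assumes t: "t > 0"
  shows "bij_betw (beads (t * n)) (cores t n) (core_beads t n)"
proof (rule bij_betw_imageI)
  have len: "length p \<le> t * n" if "is_partition p" "sum_list p = n" for p
  proof -
    have "length p \<le> sum_list p" if "\<forall>x\<in>set p. 0 < x" for p :: "nat list"
      using that by (induction p) auto
    with that have "length p \<le> n" by (auto simp: is_partition_def)
    also have "n \<le> t * n" using t by simp
    finally show ?thesis .
  qed
  show "inj_on (beads (t * n)) (cores t n)"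
  proof (rule inj_onI)
    fix p p' assume "p \<in> cores t n" "p' \<in> cores t n" "beads (t * n) p = beads (t * n) p'"
    then show "p = p'" using beads_inj[of p "t * n" p'] len[of p] len[of p'] unfolding cores_def by blast
  qed
  show "beads (t * n) ` cores t n = core_beads t n"
  proof (intro equalityI subsetI)
    fix X assume "X \<in> beads (t * n) ` cores t n"
    then obtain p where p: "is_partition p" "sum_list p = n" "is_core t p" "X = beads (t * n) p"
      by (auto simp: cores_def)
    then show "X \<in> core_beads t n"
      using card_beads is_core_iff_pushed_down[OF p(1) len t] sum_beads[OF p(1) len]
      by (auto simp: core_beads_def) (auto simp: beads_def)
  next
    fix X assume X: "X \<in> core_beads t n"
    then obtain p where p: "is_partition p" "length p \<le> t * n" "beads (t * n) p = X"
      using beads_surj[of X "t * n"] by (auto simp: core_beads_def)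
    with X have "p \<in> cores t n" 
      using is_core_iff_pushed_down[OF p(1,2) t] sum_beads[OF p(1,2)] by (auto simp: core_beads_def cores_def)
    with p show "X \<in> beads (t * n) ` cores t n" by blast
  qed
qed

definition charge_vectors :: "nat \<Rightarrow> nat \<Rightarrow> (nat \<Rightarrow> int) set" where
  "charge_vectors t n = {m \<in> sector t 0. energy t m = int n}"

lemma bij_charges_beads:
  assumes t: "t > 0"
  shows "bij_betw (\<lambda>m. fill t (\<lambda>i. nat (m i + int n))) (charge_vectors t n) (core_beads t n)"
proof (rule bij_betw_imageI)
  have nn: "m i + int n \<ge> 0" if "m \<in> charge_vectors t n" "i < t" for m i
    using charge_lower_bound[of t m n i] that by (auto simp: charge_vectors_def)
  show "inj_on (\<lambda>m. fill t (\<lambda>i. nat (m i + int n))) (charge_vectors t n)"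
  proof (rule inj_onI)
    fix m m' assume m: "m \<in> charge_vectors t n" "m' \<in> charge_vectors t n"
      and eq: "fill t (\<lambda>i. nat (m i + int n)) = fill t (\<lambda>i. nat (m' i + int n))"
    have "m i = m' i" if "i < t" for i
      using fill_eqD[OF t eq that] nn[OF m(1) that] nn[OF m(2) that] by simp
    then show "m = m'" 
      by (intro PiE_ext[of m "{..<t}" "\<lambda>_. UNIV" m']) (use m in \<open>auto simp: charge_vectors_def sector_def charges_def\<close>)
  qed
  have tot: "total_charge t (\<lambda>i. m i + int n) = total_charge t m + int (t * n)" for m
    by (simp add: total_charge_def sum.distrib)
  have mem: "fill t c \<in> core_beads t n \<longleftrightarrow> total_charge t m = 0 \<and> energy t m = int n"
    if c: "\<And>i. i < t \<Longrightarrow> int (c i) = m i + int n" for c m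
  proof -
    have "energy t (\<lambda>i. int (c i)) = energy t (\<lambda>i. m i + int n)"
         "total_charge t (\<lambda>i. int (c i)) = total_charge t (\<lambda>i. m i + int n)"
      using c by (simp_all add: energy_def total_charge_def)
    then have 1: "int (card (fill t c)) = total_charge t m + int (t * n)"
      "int (\<Sum>(fill t c)) = energy t m + int t * int n * total_charge t m + int (\<Sum>{..<t * n})"
      using card_fill[OF t, of c] sum_fill_energy[OF t, of c] tot energy_shift[of t m "int n"] energy_const[OF t, of n]
      by simp_all
    have "card (fill t c) = t * n \<longleftrightarrow> total_charge t m = 0" using 1(1) by linarith
    moreover have "\<Sum>(fill t c) = n + \<Sum>{..<t * n} \<longleftrightarrow> energy t m = int n" if "total_charge t m = 0"
    proof -
      have "int (\<Sum>(fill t c)) = energy t m + int (\<Sum>{..<t * n})"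
        using 1(2) that by (simp only: mult_zero_right add_0_right)
      moreover have "a = n + b \<longleftrightarrow> E = int n" if "int a = E + int b" for a b :: nat and E
        using that by linarith
      ultimately show ?thesis by blast
    qed
    ultimately show ?thesis using sum_fill(1)[OF t] pushed_down_fill[OF t] by (auto simp: core_beads_def)
  qed
  show "(\<lambda>m. fill t (\<lambda>i. nat (m i + int n))) ` charge_vectors t n = core_beads t n"
  proof (intro equalityI subsetI)
    fix X assume "X \<in> (\<lambda>m. fill t (\<lambda>i. nat (m i + int n))) ` charge_vectors t n"
    then show "X \<in> core_beads t n" using mem nn by (auto simp: charge_vectors_def sector_def)
  next
    fix X assume X: "X \<in> core_beads t n"
    then obtain c where c: "X = fill t c" using pushed_down_imp_fill[OF t] by (auto simp: core_beads_def)
    define m where "m = (\<lambda>i\<in>{..<t}. int (c i) - int n)"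
    have "m \<in> charge_vectors t n"
      using X mem[of c m] unfolding c by (auto simp: m_def charge_vectors_def sector_def charges_def)
    moreover have "X = fill t (\<lambda>i. nat (m i + int n))"
      unfolding c fill_def using t by (auto simp: m_def)
    ultimately show "X \<in> (\<lambda>m. fill t (\<lambda>i. nat (m i + int n))) ` charge_vectors t n" by blast
  qed
qed

lemma A_core_charge_vectors:
  assumes t: "t > 0"
  shows "finite (charge_vectors t n)" "card (charge_vectors t n) = A_core t 1 n"
proof -
  let ?C = "{ps \<in> partition_tuples 1 n. \<forall>p\<in>set ps. is_core t p}"
  have C: "?C = (\<lambda>p. [p]) ` cores t n"
    by (auto simp: partition_tuples_def cores_def length_Suc_conv)
  have inj: "inj_on (\<lambda>p. [p]) (cores t n)" by (simp add: inj_on_def)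
  have "finite ?C" using finite_partition_tuples by simp
  then have "finite (cores t n)" unfolding C using finite_imageD[OF _ inj] by blast
  then show "finite (charge_vectors t n)"
    using bij_betw_finite[OF bij_cores_beads[OF t]] bij_betw_finite[OF bij_charges_beads[OF t]] by blast
  have "card (cores t n) = A_core t 1 n"
    unfolding A_core_def C by (rule card_image[OF inj, symmetric])
  then show "card (charge_vectors t n) = A_core t 1 n"
    using bij_betw_same_card[OF bij_cores_beads[OF t, of n]] bij_betw_same_card[OF bij_charges_beads[OF t, of n]]
    by simp
qed

section \<open>Comparison of coefficients\<close>

text \<open>Collect the vectors of the zero sector by their energy.\<close>

lemma core_generating_function:
  assumes q: "0 < q" "q < 1" and t: "t > 0"
  shows "((\<lambda>n. real (A_core t 1 n) * q ^ n) has_sum sector_sum q t 0) UNIV"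
proof -
  have "((\<lambda>(n, m). q ^ n) has_sum sector_sum q t 0) (Sigma UNIV (charge_vectors t))"
    by (rule has_sum_reindex_bij_witness[where j = "\<lambda>m. (nat (energy t m), m)" and i = snd, THEN iffD1, 
          OF _ _ _ _ _ _ sector_has_sum[OF q t]])
       (auto simp: charge_vectors_def energy_nonneg power_int_def)
  then have "((\<lambda>n. \<Sum>m\<in>charge_vectors t n. q ^ n) has_sum sector_sum q t 0) UNIV"
    by (rule has_sum_SigmaD) (use A_core_charge_vectors(1)[OF t] in \<open>auto intro!: has_sum_finiteI\<close>)
  then show ?thesis using A_core_charge_vectors(2)[OF t] by simp
qed

text \<open>The zeros of a power series that is not identically zero do not accumulate at the origin, so that positive
  arguments are enough.\<close>

lemma power_series_coeffs_zero:
  fixes a :: "nat \<Rightarrow> real"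
  assumes sums: "\<And>q. 0 < q \<Longrightarrow> q < 1 \<Longrightarrow> (\<lambda>n. a n * q ^ n) sums 0" and a0: "a 0 = 0"
  shows "a n = 0"
proof (rule ccontr)
  assume n: "a n \<noteq> 0"
  define f where "f x = (\<Sum>n. a n * x ^ n)" for x
  have "(\<lambda>n. a n * (x - 0) ^ n) sums f x" if "norm (x - 0) < 1 / 2" for x
    using powser_inside[of a "1/2" x] sums[of "1/2"] that by (auto simp: f_def sums_iff summable_sums)
  moreover have "f 0 = 0" using a0 by (simp add: f_def powser_zero)
  moreover have "n > 0" using n a0 by (cases n) auto
  ultimately obtain s where s: "0 < s" "\<And>z. z \<in> cball 0 s - {0} \<Longrightarrow> f z \<noteq> 0"
    using powser_0_nonzero[of "1/2" 0 a f n] n by auto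
  define z where "z = min s (1 / 2)"
  have "0 < z" "z < 1" "z \<in> cball 0 s - {0}" using s(1) by (auto simp: z_def)
  then show False using s(2)[of z] sums[of z] by (simp add: f_def sums_iff)
qed

text \<open>The generating function of the cores, multiplied by \<open>q\<close>, and that of the divisor sums both
  become, after multiplication by \<open>euler q\<close>, \<open>q * euler (q ^ 5) ^ 5\<close>.\<close>

theorem theorem5p1:
  fixes n :: nat
  shows "int (A_core 5 1 n) = sigma1_star chi_5_3 (n + 1)"
proof -
  define a where "a k = (if k = 0 then 0 
    else real (A_core 5 1 (k - 1)) - real_of_int (sigma1_star chi_5_3 k))" for k
  have "a (n + 1) = 0"
  proof (rule power_series_coeffs_zero)
    fix q :: real assume q: "0 < q" "q < 1"
    have "chi_lambert q * euler q = (q * sector_sum q 5 0) * euler q"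
      using ramanujan_lambert[OF q] zero_sector_product[OF q, of 5] by simp
    then have eq: "chi_lambert q = q * sector_sum q 5 0" using euler_pos[OF q] by simp
    have "((\<lambda>n. q * (real (A_core 5 1 n) * q ^ n)) has_sum chi_lambert q) UNIV"
      unfolding eq by (intro has_sum_cmult_right core_generating_function q) auto
    then have "((\<lambda>k. real (A_core 5 1 (k - 1)) * q ^ k) has_sum chi_lambert q) {1..}"
      by (rule has_sum_reindex_bij_witness[where i = "\<lambda>k. k - 1" and j = Suc, THEN iffD1, rotated 6])
         (auto simp: Suc_le_eq)
    from has_sum_add[OF this has_sum_uminusI[OF chi_lambert_has_sum[OF q]]]
    have "((\<lambda>k. real (A_core 5 1 (k - 1)) * q ^ k + - (real_of_int (sigma1_star chi_5_3 k) * q ^ k)) has_sum 0) {1..}"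
      by simp
    then have "((\<lambda>k. a k * q ^ k) has_sum 0) {1..}"
      by (rule has_sum_cong[THEN iffD1, rotated]) (auto simp: a_def algebra_simps)
    then have "((\<lambda>k. a k * q ^ k) has_sum 0) UNIV"
      by (rule has_sum_cong_neutral[THEN iffD1, rotated 3]) (auto simp: a_def not_le)
    then show "(\<lambda>k. a k * q ^ k) sums 0" by (rule has_sum_imp_sums)
  qed (simp add: a_def)
  then have "real_of_int (int (A_core 5 1 n)) = real_of_int (sigma1_star chi_5_3 (n + 1))"
    by (simp add: a_def)
  then show ?thesis by (simp only: of_int_eq_iff)
qed

end
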